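(* Suppose $\epsilon>0$ (with $\epsilon<\sqrt3\pi/12$), $k\in\{0,\dots,6\}$ and $\gamma\in\Gamma_k^*\setminus\Lambda^*$. Let $m_0,\dots,m_6\in L^2(\mathbb R^2/\Lambda^* )$ satisfy $\overline{\mathcal A_{k'}}\subset\operatorname{supp}(m_{k'})\subset\overline{\mathcal A_{k'}}+\overline{B(0,\epsilon)}$ for every $k'$. Then $m_k$ cannot have a nonzero continuous extension in the normal direction beyond the boundary $$C_0(k,\gamma)\setminus\bigcup_{k'\in I_\gamma,\ k'\ne k}C_\epsilon(k',\gamma)\ \subset\ \partial\mathcal A_k$$ without violating the perfect reconstruction (shift cancellation) condition $$\sum_{k'\in I_{\gamma'}}\overline{m_{k'}(\xi+\gamma')}\,m_{k'}(\xi)=0\quad\text{for a.e. }\xi\in\mathbb R^2,\ \forall\gamma'\in\Gamma^*\setminus\Lambda^*,\qquad I_{\gamma'}=\{k':\gamma'\in\Gamma_{k'}^*\}.$$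
   Context: For a full-rank lattice $L\subset\mathbb R^2$, $L^*=\{\gamma\in\mathbb R^2:\langle\eta,\gamma\rangle\in2\pi\mathbb Z\ \forall\eta\in L\}$. Let $$\Lambda=\begin{bmatrix}1&0\\ 1/\sqrt3&2/\sqrt3\end{bmatrix}\mathbb Z^2,\quad \Gamma_0=2\Lambda,\quad \Gamma_1=\Gamma_2=\begin{bmatrix}4&4\\-4/\sqrt3&0\end{bmatrix}\mathbb Z^2,\quad \Gamma_3=\Gamma_4=\begin{bmatrix}0&-2\\8/\sqrt3&2\sqrt3\end{bmatrix}\mathbb Z^2,\quad \Gamma_5=\Gamma_6=\begin{bmatrix}4&2\\4/\sqrt3&2\sqrt3\end{bmatrix}\mathbb Z^2,$$ and $\Gamma=\bigcap_{k=0}^6\Gamma_k$. Frequency partition: $S=\{\xi\in\mathbb R^2:|\xi_1|\le\pi,\ |\xi_1+\sqrt3\xi_2|\le2\pi,\ |\xi_1-\sqrt3\xi_2|\le2\pi\}$, $A_0=\frac12S$; for $1\le k\le6$, $A_k$ is the set of $\xi\in S\setminus A_0$ such that $\xi$ or $-\xi$ has polar angle in $\Theta_k$, with $\Theta_1=[0,\frac\pi6]$, $\Theta_2=[-\frac\pi6,0]$, $\Theta_3=[-\frac\pi3,-\frac\pi6]$, $\Theta_4=[-\frac\pi2,-\frac\pi3]$, $\Theta_5=[\frac\pi3,\frac\pi2]$, $\Theta_6=[\frac\pi6,\frac\pi3]$. Put $\mathcal A_k=A_k+\Lambda^*$. The partition is admissible: for each $k$, the sets $\mathcal A_k+\gamma$,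 $\gamma\in\Gamma_k^*/\Lambda^*$, form a partition of $\mathbb R^2$ modulo null sets. For $\epsilon\ge0$ and $\gamma\in\Gamma_k^*\setminus\Lambda^*$, $$C_\epsilon(k,\gamma)=\big(\overline{\mathcal A_k}+\overline{B(0,\epsilon)}\big)\cap\big(\overline{\mathcal A_k}+\overline{B(0,\epsilon)}-\gamma\big),$$ where $B(0,\epsilon)$ is the Euclidean ball of radius $\epsilon$; in particular $C_0(k,\gamma)=\overline{\mathcal A_k}\cap(\overline{\mathcal A_k}-\gamma)\subset\partial\mathcal A_k$. Terminology: that $m_k$ has a nonzero continuous extension in the normal direction beyond a part $P$ of $\partial\mathcal A_k$ is used in the sense that $m_k$ is continuous there and there exist $x\in P$ and $y\notin\overline{\mathcal A_k}$ with $y-x\perp\partial\mathcal A_k$, $m_k(y)\ne0$, and $|y-x|>0$ sufficiently small. *)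

theory Defs
  imports "HOL-Analysis.Analysis"
begin

section \<open>Lattices\<close>

definition lattice_of :: "real^2^2 \<Rightarrow> (real^2) set" where
  "lattice_of M = {M *v z | z. \<forall>i. z $ i \<in> \<int>}"

definition dual_lattice :: "(real^2) set \<Rightarrow> (real^2) set" where
  "dual_lattice L = {\<gamma>. \<forall>\<eta>\<in>L. \<exists>n::int. \<eta> \<bullet> \<gamma> = 2 * pi * of_int n}"

text \<open>Matrices are given by their rows, so the lattice generators are the columns.\<close>

definition Lam :: "(real^2) set" where
  "Lam = lattice_of (vector [vector [1, 0], vector [1 / sqrt 3, 2 / sqrt 3]])"

definition Gam :: "nat \<Rightarrow> (real^2) set" where
  "Gam k =
    (if k = 0 then (\<lambda>\<eta>. 2 *\<^sub>R \<eta>) ` Lam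
     else if k = 1 \<or> k = 2 then
       lattice_of (vector [vector [4, 4], vector [- 4 / sqrt 3, 0]])
     else if k = 3 \<or> k = 4 then
       lattice_of (vector [vector [0, - 2], vector [8 / sqrt 3, 2 * sqrt 3]])
     else
       lattice_of (vector [vector [4, 2], vector [4 / sqrt 3, 2 * sqrt 3]]))"

definition GamAll :: "(real^2) set" where
  "GamAll = (\<Inter>k\<in>{0..6}. Gam k)"

definition Idx :: "real^2 \<Rightarrow> nat set" where
  "Idx \<gamma> = {k \<in> {0..6}. \<gamma> \<in> dual_lattice (Gam k)}"

section \<open>The frequency partition\<close>

definition hexS :: "(real^2) set" where
  "hexS = {\<xi>. \<bar>\<xi> $ 1\<bar> \<le> pi \<and> \<bar>\<xi> $ 1 + sqrt 3 * \<xi> $ 2\<bar> \<le> 2 * pi \<and>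
           \<bar>\<xi> $ 1 - sqrt 3 * \<xi> $ 2\<bar> \<le> 2 * pi}"

definition Theta :: "nat \<Rightarrow> real set" where
  "Theta k =
    (if k = 1 then {0 .. pi / 6}
     else if k = 2 then {- (pi / 6) .. 0}
     else if k = 3 then {- (pi / 3) .. - (pi / 6)}
     else if k = 4 then {- (pi / 2) .. - (pi / 3)}
     else if k = 5 then {pi / 3 .. pi / 2}
     else {pi / 6 .. pi / 3})"

definition has_polar_angle_in :: "real^2 \<Rightarrow> real set \<Rightarrow> bool" where
  "has_polar_angle_in \<xi> T \<longleftrightarrow> (\<exists>r>0. \<exists>\<theta>\<in>T. \<xi> = vector [r * cos \<theta>, r * sin \<theta>])"

definition A0 :: "(real^2) set" where
  "A0 = (\<lambda>\<xi>. (1 / 2) *\<^sub>R \<xi>) ` hexS"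

definition partA :: "nat \<Rightarrow> (real^2) set" where
  "partA k =
    (if k = 0 then A0
     else {\<xi> \<in> hexS - A0. has_polar_angle_in \<xi> (Theta k) \<or> has_polar_angle_in (- \<xi>) (Theta k)})"

text \<open>Here and below, \<open>+\<close> on sets is the Minkowski sum.\<close>

definition calA :: "nat \<Rightarrow> (real^2) set" where
  "calA k = partA k + dual_lattice Lam"

text \<open>The closed ball is \<open>cball 0 \<epsilon>\<close> rather than \<open>closure (ball 0 \<epsilon>)\<close>, so that for
  \<open>\<epsilon> = 0\<close> it is \<open>{0}\<close> and \<open>Ceps 0 k \<gamma>\<close> is the intersection of the closures themselves.\<close>

definition Ceps :: "real \<Rightarrow> nat \<Rightarrow> real^2 \<Rightarrow> (real^2) set" where
  "Ceps \<epsilon> k \<gamma> =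
    (closure (calA k) + cball 0 \<epsilon>) \<inter> (\<lambda>\<xi>. \<xi> - \<gamma>) ` (closure (calA k) + cball 0 \<epsilon>)"

section \<open>Functions on the torus\<close>

text \<open>An element of \<open>L\<^sup>2\<close> of the torus is given by an everywhere periodic representative;
  \<open>hexS\<close> is a fundamental domain of the dual lattice of \<open>Lam\<close>.\<close>

definition L2_torus :: "(real^2 \<Rightarrow> complex) \<Rightarrow> bool" where
  "L2_torus f \<longleftrightarrow>
    f \<in> borel_measurable lebesgue \<and>
    (\<forall>\<eta>\<in>dual_lattice Lam. \<forall>\<xi>. f (\<xi> + \<eta>) = f \<xi>) \<and>
    set_integrable lebesgue hexS (\<lambda>\<xi>. (cmod (f \<xi>))\<^sup>2)"

text \<open>The support of an almost-everywhere class: the complement of the largest open set on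
  which the function vanishes almost everywhere.\<close>

definition ess_supp :: "(real^2 \<Rightarrow> complex) \<Rightarrow> (real^2) set" where
  "ess_supp f = {x. \<forall>r>0. \<not> (AE \<xi> in lebesgue. \<xi> \<in> ball x r \<longrightarrow> f \<xi> = 0)}"

definition perfect_shift_cancellation :: "(nat \<Rightarrow> real^2 \<Rightarrow> complex) \<Rightarrow> bool" where
  "perfect_shift_cancellation m \<longleftrightarrow>
    (\<forall>\<gamma> \<in> dual_lattice GamAll - dual_lattice Lam.
       AE \<xi> in lebesgue. (\<Sum>k\<in>Idx \<gamma>. cnj (m k (\<xi> + \<gamma>)) * m k \<xi>) = 0)"

section \<open>Extension in the normal direction\<close>

text \<open>Tangent (contingent) cone of a set at a point.\<close>

definition tangent_cone :: "(real^2) set \<Rightarrow> real^2 \<Rightarrow> (real^2) set" where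
  "tangent_cone B x =
    {\<tau>. \<exists>s t. (\<forall>n::nat. s n \<in> B \<and> (t n :: real) > 0) \<and> t \<longlonglongrightarrow> 0 \<and>
          (\<lambda>n. (s n - x) /\<^sub>R t n) \<longlonglongrightarrow> \<tau>}"

text \<open>At a corner of a polygonal curve, only the zero vector is normal.\<close>

definition normal_at :: "(real^2) set \<Rightarrow> real^2 \<Rightarrow> real^2 \<Rightarrow> bool" where
  "normal_at B x v \<longleftrightarrow> (\<forall>\<tau> \<in> tangent_cone B x. orthogonal v \<tau>)"

text \<open>\<open>f\<close> extends beyond the part \<open>P\<close> of the boundary of \<open>D\<close>: the point \<open>y\<close> can be
  found arbitrarily close to \<open>x\<close>, and \<open>f\<close> is continuous from \<open>x\<close> up to \<open>y\<close>. Continuity at \<open>y\<close>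
  is what makes \<open>f y \<noteq> 0\<close> meaningful for a function determined only almost everywhere.\<close>

definition nonzero_normal_extension ::
    "(real^2 \<Rightarrow> complex) \<Rightarrow> (real^2) set \<Rightarrow> (real^2) set \<Rightarrow> bool" where
  "nonzero_normal_extension f D P \<longleftrightarrow>
    (\<exists>x\<in>P. \<forall>\<delta>>0. \<exists>y.
       y \<notin> closure D \<and> normal_at (frontier D) x (y - x) \<and>
       0 < norm (y - x) \<and> norm (y - x) < \<delta> \<and> f y \<noteq> 0 \<and>
       (\<forall>z \<in> closed_segment x y. isCont f z))"

end

theory Submission
  imports Defs
begin

text \<open>For \<open>k \<ge> 1\<close> choose orthogonal coordinates \<open>(P, Q)\<close> with the \<open>P\<close>-axis along the edge of the wedge
  \<open>\<Theta>\<^sub>k\<close> at angle \<open>0\<close> or \<open>\<plusminus>\<pi>/3\<close> and the wedge in the first quadrant, with units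
  making everything rational: \<open>\<Gamma>\<^sub>k\<^sup>*\<close> becomes \<open>\<int>\<^sup>2\<close>, \<open>\<Lambda>\<^sup>*\<close> the points \<open>(2a, 2b)\<close> with
  \<open>a + b\<close> even, and \<open>A\<^sub>k\<close> up to sign the trapezoid \<open>1 \<le> P \<le> 2\<close>, \<open>0 \<le> 3Q \<le> P\<close>. Since the
  \<open>\<Gamma>\<^sub>k\<^sup>*\<close>-translates pack, \<open>C\<^sub>0(k, \<gamma>)\<close> lies in the boundary.

  Let \<open>x \<in> C\<^sub>0(k, \<gamma>)\<close> and let \<open>y\<close> be a nearby point beyond the boundary in the normal direction, with
  \<open>m\<^sub>k\<close> nonzero and continuous at \<open>y\<close>. Away from the sets \<open>C\<^sub>\<epsilon>(k', \<gamma>)\<close> the shift cancellation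
  condition reduces to \<open>m\<^sub>k(\<xi> + \<gamma>) m\<^sub>k(\<xi>) = 0\<close>, so \<open>m\<^sub>k\<close> vanishes near \<open>y + \<gamma>\<close> and \<open>y + \<gamma>\<close> is
  outside the closure of \<open>\<A>\<^sub>k\<close>. On the other hand \<open>x\<close> is not a corner, as only the zero vector is
  normal there, and the translate of \<open>\<A>\<^sub>k\<close> by \<open>-\<gamma>\<close> fills the side of the edge that contains \<open>y\<close>.
  The one exception is a T-junction, where the translate touches the edge only with a corner of
  angle \<open>\<pi>/3\<close> and misses the normal; there \<open>x \<in> C\<^sub>0(k', \<gamma>)\<close> for the mirror image
  \<open>\<A>\<^sub>k\<^sub>'\<close> of \<open>\<A>\<^sub>k\<close>, which has the same lattice, so \<open>x\<close> was excluded. For \<open>k = 0\<close> the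
  hexagons tile edge to edge and no T-junctions occur.\<close>

section \<open>The trapezoid and the hexagon\<close>

text \<open>The slanted edge \<open>3 * q = p\<close> is the ray at angle \<pi>/6, because a unit of
  \<open>q\<close> is sqrt 3 times as long as a unit of \<open>p\<close>. The edges
  \<open>p = 1\<close> and \<open>p = 2\<close> come from the boundaries of \<open>A0\<close> and
  \<open>hexS\<close>.\<close>

definition trap :: "real \<Rightarrow> real \<Rightarrow> bool" where
  "trap p q \<longleftrightarrow> 1 \<le> p \<and> p \<le> 2 \<and> 0 \<le> q \<and> 3 * q \<le> p"

definition hexagon :: "real \<Rightarrow> real \<Rightarrow> bool" where
  "hexagon p q \<longleftrightarrow> \<bar>p\<bar> \<le> 1 \<and> \<bar>p + 3 * q\<bar> \<le> 2 \<and> \<bar>p - 3 * q\<bar> \<le> 2"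

lemma int_between: "real_of_int a < of_int n \<Longrightarrow> real_of_int n < of_int b \<Longrightarrow> a < n \<and> n < b" for n :: int
  by simp

text \<open>Here \<open>(p, q)\<close> and \<open>(p', q')\<close> are the positions of \<open>x\<close> and \<open>x + \<gamma>\<close> in the trapezoids
  containing them, \<open>\<sigma>\<close> is the relative sign of the two trapezoids, and \<open>(v, z)\<close> is \<open>y - x\<close>. All
  inactive constraints have slack at least \<open>4\<delta>\<close>, which a displacement by \<open>\<delta>\<close> in each coordinate
  cannot use up. The assumption \<open>bad\<close> excludes the T-junction.\<close>

lemma trap_cover:
  fixes p q p' q' v z \<delta> \<sigma> :: real and C D :: int
  assumes t: "trap p q" and t': "trap p' q'" and \<sigma>: "\<sigma> = 1 \<or> \<sigma> = -1"
    and C: "p - \<sigma> * p' = of_int C" and D: "q - \<sigma> * q' = of_int D"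
    and ne: "\<not> (C = 0 \<and> D = 0)"
    and bad: "\<not> (\<sigma> = -1 \<and> p = 2 \<and> q = 1/3 \<and> p' = 2 \<and> q' = 2/3)"
    and v0: "v \<noteq> 0 \<or> z \<noteq> 0" and small: "\<bar>v\<bar> \<le> \<delta>" "\<bar>z\<bar> \<le> \<delta>"
    and \<delta>: "p = 1 \<or> p \<ge> 1 + 4*\<delta>" "p = 2 \<or> p \<le> 2 - 4*\<delta>" "q = 0 \<or> q \<ge> 4*\<delta>" "3*q = p \<or> 3*q \<le> p - 4*\<delta>"
    and \<delta>': "p' = 1 \<or> p' \<ge> 1 + 4*\<delta>" "p' = 2 \<or> p' \<le> 2 - 4*\<delta>" "q' = 0 \<or> q' \<ge> 4*\<delta>" "3*q' = p' \<or> 3*q' \<le> p' - 4*\<delta>"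
    and normal: "q = 0 \<Longrightarrow> v = 0" "3 * q = p \<Longrightarrow> z = - v" "p = 1 \<Longrightarrow> z = 0" "p = 2 \<Longrightarrow> z = 0"
  shows "trap (p + v) (q + z) \<or> trap (p' + \<sigma> * v) (q' + \<sigma> * z)"
proof -
  have pos: "\<delta> > 0" using v0 small by linarith
  \<comment> \<open>At a corner two edges are active, and their normality conditions together force
    \<open>v = z = 0\<close>. Hence at most one edge is active.\<close>
  consider (inside) "p \<ge> 1 + 4*\<delta>" "p \<le> 2 - 4*\<delta>" "q \<ge> 4*\<delta>" "3*q \<le> p - 4*\<delta>"
    | (bottom) "q = 0" "v = 0" "p \<ge> 1 + 4*\<delta>" "p \<le> 2 - 4*\<delta>" 
    | (slant) "3*q = p" "z = -v" "p \<ge> 1 + 4*\<delta>" "p \<le> 2 - 4*\<delta>"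
    | (left) "p = 1" "z = 0" "q \<ge> 4*\<delta>" "3*q \<le> p - 4*\<delta>"
    | (right) "p = 2" "z = 0" "q \<ge> 4*\<delta>" "3*q \<le> p - 4*\<delta>"
    using \<delta> normal v0 t unfolding trap_def by argo
  note cs = this
  \<comment> \<open>Integrality leaves few relative positions. Equally oriented tiles have
    \<open>C = p - p'\<close> in [-1, 1] and \<open>\<bar>D\<bar> < 1\<close>; oppositely oriented
    ones have \<open>C = p + p'\<close> in [2, 4] and \<open>D = q + q'\<close> in [0, 4/3].\<close>
  consider "\<sigma> = 1" "real_of_int D = 0" "real_of_int C = -1 \<or> real_of_int C = 1"
    | "\<sigma> = -1" "real_of_int D = 0 \<or> real_of_int D = 1" 
      "real_of_int C = 2 \<or> real_of_int C = 3 \<or> real_of_int C = 4"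
  proof (cases "\<sigma> = 1")
    case True
    have "-2 < C \<and> C < 2" using t t' C True unfolding trap_def
      by (intro int_between; simp; linarith)
    moreover have "-1 < D \<and> D < 1" using t t' D True unfolding trap_def
      by (intro int_between; simp; linarith)
    ultimately have "D = 0" "C = -1 \<or> C = 1" using ne by auto
    then show ?thesis using that(1) True by auto
  next
    case False
    then have s: "\<sigma> = -1" using \<sigma> by auto
    have "1 < C \<and> C < 5" using t t' C s unfolding trap_def
      by (intro int_between; simp; linarith)
    moreover have "-1 < D \<and> D < 2" using t t' D s unfolding trap_def
      by (intro int_between; simp; linarith)
    ultimately have "D = 0 \<or> D = 1" "C = 2 \<or> C = 3 \<or> C = 4" by auto
    then show ?thesis using that(2) s by auto
  qed
  then show ?thesis
  proof cases
    case 1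
    \<comment> \<open>Equally oriented tiles touch only along vertical edges. Even at the corner (1,
      1/3), whose angle is obtuse, the tile contains the horizontal normal direction.\<close>
    have "q' = q" "p - p' = -1 \<or> p - p' = 1" using C D 1 by auto
    with cs show ?thesis
      using t t' small \<delta>' pos unfolding trap_def 1(1)
      by cases (simp only: mult_1; smt (z3))+
  next
    case 2
    have e: "p + p' = 2 \<or> p + p' = 3 \<or> p + p' = 4" "q + q' = 0 \<or> q + q' = 1"
      using C D 2 by auto
    from cs show ?thesis
    proof cases
      case inside
      then show ?thesis using small pos unfolding trap_def by argo
    next
      case bottom
      then have "q' = 0" using e(2) t' unfolding trap_def by argo
      then show ?thesis using bottom small pos t' unfolding trap_def 2(1) by (cases "z \<ge> 0"; simp; argo)
    next
      case slant
      then have "p + p' = 3" "q + q' = 1" using e t t' pos unfolding trap_def by argo+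
      then show ?thesis using slant small pos t' unfolding trap_def 2(1) by (cases "v \<ge> 0"; simp; argo)
    next
      case left
      \<comment> \<open>A half-turned tile reaches the edge \<open>p = 1\<close> only at the end
        points of that edge, which are corners.\<close>
      then have False using e t t' pos unfolding trap_def by argo
      then show ?thesis ..
    next
      case right
      then have "p' = 2" "q + q' = 1" using e t t' pos unfolding trap_def by argo+
      \<comment> \<open>Since \<open>q + q' = 1\<close>, the sharp corner \<open>q' = 2/3\<close>
        sits exactly at \<open>q = 1/3\<close>. This is the T-junction that \<open>bad\<close> rules
        out.\<close>
      moreover from this have "3 * q' \<le> p' - 4 * \<delta>" using bad right 2(1) \<delta>'(4) by argo
      ultimately show ?thesis using right small pos t' unfolding trap_def 2(1) by (cases "v \<le> 0"; simp; argo)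
    qed
  qed
qed

text \<open>The bounds and parity leave the six hexagons adjacent to the given one. Each shares a
  full edge with it, so leaving through that edge along the normal enters the neighbour; at a corner
  the normality conditions contradict \<open>v0\<close>.\<close>

lemma hexagon_cover:
  fixes p q v z \<delta> :: real and a b :: int
  assumes t: "hexagon p q" and t': "hexagon (p + of_int a) (q + of_int b)"
    and ev: "even (a + b)" and ne: "\<not> (a = 0 \<and> b = 0)"
    and v0: "v \<noteq> 0 \<or> z \<noteq> 0" and small: "\<bar>v\<bar> \<le> \<delta>" "\<bar>z\<bar> \<le> \<delta>"
    and \<delta>: "\<bar>p\<bar> = 1 \<or> \<bar>p\<bar> \<le> 1 - 4*\<delta>" "\<bar>p + 3*q\<bar> = 2 \<or> \<bar>p + 3*q\<bar> \<le> 2 - 4*\<delta>"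
      "\<bar>p - 3*q\<bar> = 2 \<or> \<bar>p - 3*q\<bar> \<le> 2 - 4*\<delta>"
    and normal: "\<bar>p\<bar> = 1 \<Longrightarrow> z = 0" "\<bar>p + 3*q\<bar> = 2 \<Longrightarrow> z = v" "\<bar>p - 3*q\<bar> = 2 \<Longrightarrow> z = - v"
  shows "hexagon (p + v) (q + z) \<or> hexagon (p + of_int a + v) (q + of_int b + z)"
proof -
  have "-3 < a \<and> a < 3" using t t' unfolding hexagon_def
    by (intro int_between; simp; linarith)
  moreover have "-2 < b \<and> b < 2" using t t' unfolding hexagon_def
    by (intro int_between; simp; linarith)
  ultimately have "a \<in> {-2,-1,0,1,2}" "b \<in> {-1,0,1}" by auto
  then consider "a = 2" "b = 0" | "a = -2" "b = 0" | "a = 1" "b = 1" | "a = 1" "b = -1"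
     | "a = -1" "b = 1" | "a = -1" "b = -1"
    using ev ne by auto
  then show ?thesis using t t' small \<delta> normal v0 unfolding hexagon_def by cases (simp; smt (verit))+
qed

section \<open>Shift cancellation and essential supports\<close>

lemma AE_lebesgue_iff_negligible:
  fixes R :: "'a::euclidean_space \<Rightarrow> bool"
  shows "(AE x in lebesgue. R x) \<longleftrightarrow> negligible {x. \<not> R x}"
  unfolding eventually_ae_filter_negligible using negligible_subset by blast

lemma AE_lebesgue_shift:
  fixes a :: "'a::euclidean_space"
  assumes "AE x in lebesgue. R x"
  shows "AE x in lebesgue. R (x + a)"
proof -
  have "{x. \<not> R (x + a)} \<subseteq> (+) (- a) ` {x. \<not> R x}"
    by (auto intro: image_eqI[where x = "_ + a"])
  moreover have "negligible ((+) (- a) ` {x. \<not> R x})"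
    using assms by (intro negligible_translation) (simp add: AE_lebesgue_iff_negligible)
  ultimately show ?thesis
    unfolding AE_lebesgue_iff_negligible by (rule negligible_subset[rotated])
qed

text \<open>Every point off the support has a ball on which \<open>f\<close> vanishes almost
  everywhere, so the exceptional set is locally negligible. By second countability it is
  negligible.\<close>

lemma AE_zero_off_ess_supp: "AE \<xi> in lebesgue. \<xi> \<notin> ess_supp f \<longrightarrow> f \<xi> = 0"
proof -
  let ?S = "{\<xi>. \<xi> \<notin> ess_supp f \<and> f \<xi> \<noteq> 0}"
  have "\<exists>U. openin (top_of_set ?S) U \<and> x \<in> U \<and> negligible U" if x: "x \<in> ?S" for x
  proof -
    obtain r where r: "r > 0" "negligible {\<xi>. \<not> (\<xi> \<in> ball x r \<longrightarrow> f \<xi> = 0)}"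
      using x unfolding ess_supp_def AE_lebesgue_iff_negligible by blast
    have "negligible (?S \<inter> ball x r)"
      by (rule negligible_subset[OF r(2)]) auto
    then show ?thesis using r x by (intro exI[of _ "?S \<inter> ball x r"]) auto
  qed
  then have "negligible ?S" using locally_negligible_alt by blast
  then show ?thesis unfolding AE_lebesgue_iff_negligible by (simp add: conj_commute)
qed

lemma closed_plus_compact:
  fixes S T :: "'a::real_normed_vector set"
  assumes "closed S" "compact T"
  shows "closed (S + T)"
proof -
  have "S + T = (\<Union>x\<in>S. \<Union>y\<in>T. {x + y})" by (auto simp: set_plus_def)
  then show ?thesis using closed_compact_sums[OF assms] by simp
qed

lemma closed_Ceps: "closed (Ceps \<epsilon> k \<gamma>)"
  unfolding Ceps_def
  by (intro closed_Int closed_plus_compact closed_translation_subtract) auto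

text \<open>Off \<open>Ceps \<epsilon> k' \<gamma>\<close> one of the two factors of the
  \<open>k'\<close>-th summand vanishes almost everywhere, so near \<open>y\<close> only the summand
  of \<open>k\<close> survives. There \<open>m k\<close> is nonzero, hence its shift by
  \<open>\<gamma>\<close> vanishes almost everywhere near \<open>y\<close>.\<close>

lemma shift_cancellation_no_extension:
  fixes m :: "nat \<Rightarrow> real^2 \<Rightarrow> complex"
  assumes k: "k \<in> Idx \<gamma>" and \<gamma>: "\<gamma> \<in> dual_lattice GamAll - dual_lattice Lam"
    and psc: "perfect_shift_cancellation m"
    and sup: "\<And>k'. k' \<in> Idx \<gamma> \<Longrightarrow> ess_supp (m k') \<subseteq> closure (calA k') + cball 0 \<epsilon>"
    and y: "\<And>k'. k' \<in> Idx \<gamma> - {k} \<Longrightarrow> y \<notin> Ceps \<epsilon> k' \<gamma>"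
    and my: "isCont (m k) y" "m k y \<noteq> 0"
  shows "y + \<gamma> \<notin> ess_supp (m k)"
proof -
  let ?O = "- (\<Union>k'\<in>Idx \<gamma> - {k}. Ceps \<epsilon> k' \<gamma>)"
  have fin: "finite (Idx \<gamma>)" unfolding Idx_def by simp
  have "open ?O"
    using fin closed_Ceps by (intro open_Compl closed_UN) auto
  moreover have "y \<in> ?O" using y by blast
  ultimately obtain r1 where r1: "r1 > 0" "ball y r1 \<subseteq> ?O"
    by (rule openE)
  \<comment> \<open>Continuity spreads the single nonzero value over a ball, where it can be
    compared with almost-everywhere statements.\<close>
  obtain r2 where r2: "r2 > 0" "\<And>z. dist y z < r2 \<Longrightarrow> m k z \<noteq> 0"
    using continuous_at_avoid[OF my] by blast
  define r where "r = min r1 r2"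
  have r: "r > 0" "ball y r \<subseteq> ?O" "\<And>z. z \<in> ball y r \<Longrightarrow> m k z \<noteq> 0"
    using r1 r2 by (auto simp: r_def)
  have "AE \<xi> in lebesgue. (\<Sum>k\<in>Idx \<gamma>. cnj (m k (\<xi> + \<gamma>)) * m k \<xi>) = 0"
    using psc \<gamma> unfolding perfect_shift_cancellation_def by blast
  moreover have "AE \<xi> in lebesgue. \<forall>k'\<in>Idx \<gamma>. \<xi> \<notin> ess_supp (m k') \<longrightarrow> m k' \<xi> = 0"
    using fin AE_zero_off_ess_supp by (intro AE_finite_allI)
  moreover have "AE \<xi> in lebesgue. \<forall>k'\<in>Idx \<gamma>. \<xi> + \<gamma> \<notin> ess_supp (m k') \<longrightarrow> m k' (\<xi> + \<gamma>) = 0"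
    using fin AE_lebesgue_shift[OF AE_zero_off_ess_supp] by (intro AE_finite_allI)
  ultimately have "AE \<xi> in lebesgue. \<xi> \<in> ball y r \<longrightarrow> m k (\<xi> + \<gamma>) = 0"
  proof eventually_elim
    case (elim \<xi>)
    show ?case
    proof
      assume \<xi>: "\<xi> \<in> ball y r"
      have "cnj (m k' (\<xi> + \<gamma>)) * m k' \<xi> = 0" if k': "k' \<in> Idx \<gamma> - {k}" for k'
      proof -
        have "\<xi> \<notin> Ceps \<epsilon> k' \<gamma>" using r(2) \<xi> k' by blast
        then have "\<xi> \<notin> ess_supp (m k') \<or> \<xi> + \<gamma> \<notin> ess_supp (m k')"
          using sup[of k'] k' unfolding Ceps_def
          by (auto intro: image_eqI[where x = "\<xi> + \<gamma>"])
        then show ?thesis using elim k' by auto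
      qed
      then have "(\<Sum>k'\<in>Idx \<gamma> - {k}. cnj (m k' (\<xi> + \<gamma>)) * m k' \<xi>) = 0"
        by (intro sum.neutral) blast
      then have "(\<Sum>k\<in>Idx \<gamma>. cnj (m k (\<xi> + \<gamma>)) * m k \<xi>) = cnj (m k (\<xi> + \<gamma>)) * m k \<xi>"
        by (subst sum.remove[OF fin k]) simp
      then show "m k (\<xi> + \<gamma>) = 0" using elim(1) r(3)[OF \<xi>] by auto
    qed
  qed
  \<comment> \<open>Shifting by \<open>- \<gamma>\<close> recentres the ball at
    \<open>y + \<gamma>\<close>.\<close>
  from AE_lebesgue_shift[OF this, of "- \<gamma>"]
  have "AE \<xi> in lebesgue. \<xi> \<in> ball (y + \<gamma>) r \<longrightarrow> m k \<xi> = 0"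
    by (simp add: dist_norm algebra_simps)
  then show ?thesis using r(1) unfolding ess_supp_def by blast
qed

section \<open>Tangent directions and frontiers of packings\<close>

lemma tangent_cone_ray:
  assumes "\<tau>0 > 0" "\<And>\<tau>. 0 < \<tau> \<Longrightarrow> \<tau> < \<tau>0 \<Longrightarrow> x + \<tau> *\<^sub>R d \<in> B"
  shows "d \<in> tangent_cone B x"
proof -
  \<comment> \<open>The double successor keeps \<open>t n\<close> strictly below
    \<open>\<tau>0\<close> also for \<open>n = 0\<close>.\<close>
  define t where "t n = \<tau>0 * inverse (real (Suc (Suc n)))" for n
  have t: "0 < t n" "t n < \<tau>0" for n
    using assms(1) by (auto simp: t_def field_simps intro: add_pos_nonneg)
  have "(\<lambda>n. inverse (real (Suc (Suc n)))) \<longlonglongrightarrow> 0"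
    by (rule LIMSEQ_Suc[OF LIMSEQ_inverse_real_of_nat])
  then have "t \<longlonglongrightarrow> 0" unfolding t_def by (rule tendsto_mult_right_zero)
  moreover have "((x + t n *\<^sub>R d) - x) /\<^sub>R t n = d" for n using t(1)[of n] by simp
  ultimately show ?thesis
    unfolding tangent_cone_def using assms(2) t
    by (intro CollectI exI[of _ "\<lambda>n. x + t n *\<^sub>R d"] exI[of _ t]) auto
qed

text \<open>If \<open>x\<close> were interior to \<open>A\<close>, the translate of the interior by
  \<open>\<gamma>\<close> would be an open neighbourhood of \<open>x + \<gamma>\<close>. It would
  therefore meet \<open>U\<close>, against \<open>disj\<close>. In the applications \<open>U\<close>
  is the union of the open tiles.\<close>

lemma frontier_of_packing:
  fixes A U F :: "'a::real_normed_vector set"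
  assumes F: "closure A = F" "F \<subseteq> closure U"
    and disj: "\<And>z. z \<in> U \<Longrightarrow> z - \<gamma> \<notin> F" and x: "x \<in> F" "x + \<gamma> \<in> F"
  shows "x \<in> frontier A"
proof -
  have "x \<notin> interior A"
  proof
    assume "x \<in> interior A"
    then have "x + \<gamma> \<in> (+) \<gamma> ` interior A" by (simp add: add.commute)
    then have "(+) \<gamma> ` interior A \<inter> closure U \<noteq> {}" using x(2) F(2) by auto
    moreover have "open ((+) \<gamma> ` interior A)" by (simp add: open_translation)
    ultimately have "(+) \<gamma> ` interior A \<inter> U \<noteq> {}"
      using open_Int_closure_eq_empty[of "(+) \<gamma> ` interior A" U] by simp
    then obtain z where z: "\<gamma> + z \<in> U" "z \<in> interior A" by auto
    then have "z \<in> F" using interior_subset closure_subset F(1) by (auto dest: subsetD)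
    then show False using disj[OF z(1)] by simp
  qed
  then show ?thesis using x(1) F(1) by (simp add: frontier_def)
qed

section \<open>Adapted coordinates\<close>

definition open_trap :: "real \<Rightarrow> real \<Rightarrow> bool" where
  "open_trap p q \<longleftrightarrow> 1 < p \<and> p < 2 \<and> 0 < q \<and> 3 * q < p"

definition hex_lattice :: "real \<Rightarrow> real \<Rightarrow> bool" where
  "hex_lattice p q \<longleftrightarrow> (\<exists>a b :: int. even (a + b) \<and> p = 2 * of_int a \<and> q = 2 * of_int b)"

text \<open>Both signs occur because A_k contains \<open>- \<xi>\<close> along with
  \<open>\<xi>\<close>. In the frame of \<open>k\<close> this describes the closure of
  \<open>calA k\<close>.\<close>

definition traps :: "real \<Rightarrow> real \<Rightarrow> bool" where
  "traps p q \<longleftrightarrow> (\<exists>a b. hex_lattice a b \<and> (\<exists>s\<in>{1,-1}. trap (s * (p - a)) (s * (q - b))))"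

section \<open>Arithmetic of the hexagonal lattice and its symmetries\<close>

lemma hex_lattice_add: "hex_lattice a b \<Longrightarrow> hex_lattice a' b' \<Longrightarrow> hex_lattice (a + a') (b + b')"
proof -
  assume "hex_lattice a b" "hex_lattice a' b'"
  then obtain m n m' n' :: int where "even (m + n)" "a = 2 * of_int m" "b = 2 * of_int n"
    "even (m' + n')" "a' = 2 * of_int m'" "b' = 2 * of_int n'"
    unfolding hex_lattice_def by blast
  then show ?thesis
    unfolding hex_lattice_def by (intro exI[of _ "m + m'"] exI[of _ "n + n'"]) auto
qed

lemma hex_lattice_minus_iff [simp]: "hex_lattice (- a) (- b) \<longleftrightarrow> hex_lattice a b"
proof -
  have "hex_lattice (- a) (- b)" if "hex_lattice a b" for a b
  proof -
    obtain m n :: int where "even (m + n)" "a = 2 * of_int m" "b = 2 * of_int n"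
      using \<open>hex_lattice a b\<close> unfolding hex_lattice_def by blast
    then show ?thesis unfolding hex_lattice_def by (intro exI[of _ "-m"] exI[of _ "-n"]) auto
  qed
  from this[of a b] this[of "-a" "-b"] show ?thesis by auto
qed

lemma hex_lattice_diff: "hex_lattice a b \<Longrightarrow> hex_lattice a' b' \<Longrightarrow> hex_lattice (a - a') (b - b')"
  using hex_lattice_add[of a b "-a'" "-b'"] by simp

lemma hex_lattice_scale: "s \<in> {1,-1} \<Longrightarrow> hex_lattice (s * a) (s * b) \<longleftrightarrow> hex_lattice a b"
  by auto

lemma hex_lattice_reflect: "hex_lattice p (- q) \<longleftrightarrow> hex_lattice p q"
proof -
  have "hex_lattice p (- q)" if "hex_lattice p q" for p q
  proof -
    obtain m n :: int where "even (m + n)" "p = 2 * of_int m" "q = 2 * of_int n"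
      using \<open>hex_lattice p q\<close> unfolding hex_lattice_def by blast
    then show ?thesis unfolding hex_lattice_def by (intro exI[of _ m] exI[of _ "-n"]) auto
  qed
  from this[of p q] this[of p "-q"] show ?thesis by auto
qed

lemma hex_lattice_0 [simp]: "hex_lattice 0 0"
  unfolding hex_lattice_def by (intro exI[of _ 0]) simp

lemma hex_lattice_of_int:
  "hex_lattice (of_int C) (of_int D) \<longleftrightarrow> even C \<and> even D \<and> even (C div 2 + D div 2)"
proof
  assume "hex_lattice (of_int C) (of_int D)"
  then obtain a b :: int
    where ev: "even (a + b)" and "real_of_int C = of_int (2 * a)" "real_of_int D = of_int (2 * b)"
    unfolding hex_lattice_def by auto
  then have "C = 2 * a" "D = 2 * b" by (simp_all only: of_int_eq_iff)
  with ev show "even C \<and> even D \<and> even (C div 2 + D div 2)" by simp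
next
  assume "even C \<and> even D \<and> even (C div 2 + D div 2)"
  moreover from this obtain a b where "C = 2 * a" "D = 2 * b" by (auto elim!: evenE)
  ultimately show "hex_lattice (of_int C) (of_int D)" unfolding hex_lattice_def by auto
qed

lemma traps_translate:
  assumes "hex_lattice a b"
  shows "traps (p + a) (q + b) \<longleftrightarrow> traps p q"
proof -
  have "traps (p + a) (q + b)" if "hex_lattice a b" "traps p q" for p q a b
  proof -
    obtain a' b' s where "hex_lattice a' b'" "s \<in> {1,-1}" "trap (s * (p - a')) (s * (q - b'))"
      using \<open>traps p q\<close> unfolding traps_def by blast
    then show ?thesis unfolding traps_def using hex_lattice_add[OF \<open>hex_lattice a b\<close>]
      by (intro exI[of _ "a + a'"] exI[of _ "b + b'"]) (auto simp: algebra_simps)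
  qed
  from this[OF assms, of p q] this[of "-a" "-b" "p + a" "q + b"] show ?thesis using assms by auto
qed

lemma traps_minus [simp]: "traps (- p) (- q) \<longleftrightarrow> traps p q"
proof -
  have "traps (- p) (- q)" if "traps p q" for p q
  proof -
    obtain a b s where "hex_lattice a b" "s \<in> {1,-1}" "trap (s * (p - a)) (s * (q - b))"
      using \<open>traps p q\<close> unfolding traps_def by blast
    then show ?thesis unfolding traps_def
      by (intro exI[of _ "-a"] exI[of _ "-b"] conjI bexI[of _ "-s"]) (auto simp: algebra_simps)
  qed
  from this[of p q] this[of "-p" "-q"] show ?thesis by auto
qed

lemma trap_imp_traps: "trap p q \<Longrightarrow> traps p q"
  unfolding traps_def by (intro exI[of _ 0]) auto

lemma traps_scale: "s \<in> {1,-1} \<Longrightarrow> traps (s * p) (s * q) \<longleftrightarrow> traps p q"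
  by auto

text \<open>A trapezoid and its half-turned copy shifted by (3, 1) fill a unit square, a fundamental
  domain of the integer lattice. Accordingly, an overlap with equal orientation forces offset zero,
  and a half-turned overlap would need an offset (3, \<open>F\<close>) with
  \<open>0 < F < 1\<close>.\<close>

lemma open_trap_packing:
  fixes p q :: real and C D :: int
  assumes pq: "open_trap p q" and "traps (p - of_int C) (q - of_int D)"
  shows "hex_lattice (of_int C) (of_int D)"
proof -
  obtain a b :: int and s :: real where ev: "even (a + b)" and s: "s = 1 \<or> s = -1"
    and t: "trap (s * (p - of_int C - 2 * of_int a)) (s * (q - of_int D - 2 * of_int b))"
    using assms(2) unfolding traps_def hex_lattice_def by blast
  define E F where "E = C + 2 * a" and "F = D + 2 * b"
  have t': "trap (s * (p - of_int E)) (s * (q - of_int F))"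
    using t by (simp add: E_def F_def algebra_simps)
  have "E = 0 \<and> F = 0"
  proof (cases "s = 1")
    case True
    have "-1 < E \<and> E < 1" using pq t' True unfolding trap_def open_trap_def
      by (intro int_between; simp; linarith)
    moreover have "-1 < F \<and> F < 1" using pq t' True unfolding trap_def open_trap_def
      by (intro int_between; simp; linarith)
    ultimately show ?thesis by simp
  next
    case False
    then have s: "s = -1" using s by simp
    have "2 < E \<and> E < 4" using pq t' s unfolding trap_def open_trap_def
      by (intro int_between; simp; linarith)
    then have E: "E = 3" by simp
    have "0 < F \<and> F < 1" using pq t' s unfolding trap_def open_trap_def E
      by (intro int_between; simp; linarith)
    then show ?thesis by simp
  qed
  then have "C = 2 * (- a)" "D = 2 * (- b)" by (auto simp: E_def F_def)
  then show ?thesis using ev unfolding hex_lattice_def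
    by (intro exI[of _ "-a"] exI[of _ "-b"]) auto
qed

text \<open>A tile touching another across each edge point is what puts the whole edge into the
  frontier.\<close>

lemma trap_edge_neighbour:
  assumes t: "trap p q" and e: "q = 0 \<or> 3 * q = p \<or> p = 1 \<or> p = 2"
  obtains C D :: int where "\<not> hex_lattice (of_int C) (of_int D)" "traps (p + of_int C) (q + of_int D)"
proof -
  have refl: "traps x y" if "trap (- x) (- y)" for x y
    using trap_imp_traps[OF that] by simp
  \<comment> \<open>The edge \<open>p = 2\<close> is twice as long as \<open>p = 1\<close>: its
    lower half meets an equally oriented tile, its upper half a half-turned one. They join at the
    T-junction \<open>q = 1/3\<close>.\<close>
  consider "q = 0" | "3 * q = p" | "p = 1" "q \<le> 1/3" | "p = 2" "q \<le> 1/3" | "p = 2" "1/3 \<le> q"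
    using e t unfolding trap_def by argo
  then show ?thesis
  proof cases
    case 1
    then have "traps (p + of_int (-3)) (q + of_int 0)"
      using t by (intro refl) (simp add: trap_def)
    then show ?thesis using hex_lattice_of_int[of "-3" 0] by (intro that[of "-3" 0]) auto
  next
    case 2
    then have "traps (p + of_int (-3)) (q + of_int (-1))"
      using t by (intro refl) (simp add: trap_def)
    then show ?thesis using hex_lattice_of_int[of "-3" "-1"] by (intro that[of "-3" "-1"]) auto
  next
    case 3
    then have "traps (p + of_int 1) (q + of_int 0)"
      using t by (intro trap_imp_traps) (simp add: trap_def)
    then show ?thesis using hex_lattice_of_int[of 1 0] by (intro that[of 1 0]) auto
  next
    case 4
    then have "traps (p + of_int (-1)) (q + of_int 0)"
      using t by (intro trap_imp_traps) (simp add: trap_def)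
    then show ?thesis using hex_lattice_of_int[of "-1" 0] by (intro that[of "-1" 0]) auto
  next
    case 5
    then have "traps (p + of_int (-4)) (q + of_int (-1))"
      using t by (intro refl) (simp add: trap_def)
    then show ?thesis using hex_lattice_of_int[of "-4" "-1"] by (intro that[of "-4" "-1"]) auto
  qed
qed

text \<open>(3/2, 1/4) is an interior point of the trapezoid; contraction towards it enters the
  interior by convexity.\<close>

lemma trap_shrink:
  assumes "trap p q" "0 < \<tau>" "\<tau> < 1"
  shows "open_trap (p + \<tau> * (3/2 - p)) (q + \<tau> * (1/4 - q))"
proof -
  have "0 \<le> (1 - \<tau>) * (p - 1)" "0 \<le> (1 - \<tau>) * (2 - p)" "0 \<le> (1 - \<tau>) * q" "0 \<le> (1 - \<tau>) * (p - 3 * q)"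
    using assms by (auto simp: trap_def intro!: mult_nonneg_nonneg)
  then show ?thesis using assms(2) unfolding open_trap_def by (simp add: algebra_simps)
qed

lemma in_closure_ray:
  fixes x d :: "'a::real_normed_vector"
  assumes "\<And>\<tau>. 0 < \<tau> \<Longrightarrow> \<tau> < 1 \<Longrightarrow> x + \<tau> *\<^sub>R d \<in> U"
  shows "x \<in> closure U"
proof -
  have "(\<lambda>n. x + inverse (real (Suc (Suc n))) *\<^sub>R d) \<longlonglongrightarrow> x + 0 *\<^sub>R d"
    by (intro tendsto_intros LIMSEQ_Suc[OF LIMSEQ_inverse_real_of_nat])
  moreover have "x + inverse (real (Suc (Suc n))) *\<^sub>R d \<in> U" for n
    by (rule assms) (auto simp: field_simps)
  ultimately show ?thesis
    unfolding closure_sequential by (intro exI[of _ "\<lambda>n. x + inverse (real (Suc (Suc n))) *\<^sub>R d"]) auto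
qed

text \<open>The factor 4 covers constraints such as \<open>3 * q \<le> p\<close>, which a
  displacement by \<open>\<delta>\<close> in each coordinate changes by up to
  \<open>4 * \<delta>\<close>. Inserting 1 keeps the minimum over a nonempty set.\<close>

lemma common_slack:
  fixes Z :: "real set"
  assumes "finite Z" "\<And>z. z \<in> Z \<Longrightarrow> 0 \<le> z"
  obtains \<delta> where "\<delta> > 0" "\<And>z. z \<in> Z \<Longrightarrow> z = 0 \<or> 4 * \<delta> \<le> z"
proof -
  define \<delta> where "\<delta> = Min (insert 1 (Z - {0})) / 4"
  have "\<delta> > 0" using assms by (auto simp: \<delta>_def Min_gr_iff order.order_iff_strict)
  moreover have "z = 0 \<or> 4 * \<delta> \<le> z" if "z \<in> Z" for z
    using assms(1) that by (auto simp: \<delta>_def intro!: Min_le)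
  ultimately show ?thesis using that by blast
qed

lemma closed_dual_lattice: "closed (dual_lattice L)"
proof -
  have "dual_lattice L = (\<Inter>\<eta>\<in>L. (\<lambda>\<gamma>. (\<eta> \<bullet> \<gamma>) / (2 * pi)) -` \<int>)"
    unfolding dual_lattice_def Ints_def by (auto simp: field_simps)
  then show ?thesis
    by (auto intro!: closed_INT continuous_closed_vimage closed_Ints continuous_intros)
qed

text \<open>The weight 3 in the inner product pays for rational coordinates: the axes are
  orthogonal, but the units of \<open>P\<close> and \<open>Q\<close> have length ratio 1 to sqrt
  3.\<close>

locale hex_frame =
  fixes P Q :: "real^2 \<Rightarrow> real" and c :: real
  assumes lin: "linear P" "linear Q" and c: "c > 0"
    and inner_eq: "x \<bullet> y = c * (P x * P y + 3 * Q x * Q y)"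
    and surj: "\<exists>x. P x = a \<and> Q x = b"
    and dual_Lam: "x \<in> dual_lattice Lam \<longleftrightarrow> hex_lattice (P x) (Q x)"
begin

lemmas coord_simps [simp] =
  linear_add[OF lin(1)] linear_add[OF lin(2)] linear_diff[OF lin(1)] linear_diff[OF lin(2)]
  linear_scale[OF lin(1)] linear_scale[OF lin(2)]

lemma coord_eqI: "P x = P y \<Longrightarrow> Q x = Q y \<Longrightarrow> x = y"
  using inner_eq[of "x - y" "x - y"] by simp

lemma continuous_coords [continuous_intros]: "continuous_on S P" "continuous_on S Q"
  using lin by (auto intro: linear_continuous_on linear_conv_bounded_linear[THEN iffD1])

lemma coords_bounded:
  obtains K where "K > 0" "\<And>v. \<bar>P v\<bar> \<le> K * norm v" "\<And>v. \<bar>Q v\<bar> \<le> K * norm v"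
proof -
  obtain K1 where K1: "K1 > 0" "\<And>v. norm (P v) \<le> K1 * norm v" using linear_bounded_pos[OF lin(1)] by blast
  obtain K2 where K2: "K2 > 0" "\<And>v. norm (Q v) \<le> K2 * norm v" using linear_bounded_pos[OF lin(2)] by blast
  show ?thesis
  proof (rule that[of "K1 + K2"])
    fix v :: "real^2"
    have "0 \<le> K1 * norm v" "0 \<le> K2 * norm v" using K1 K2 by auto
    then show "\<bar>P v\<bar> \<le> (K1 + K2) * norm v" "\<bar>Q v\<bar> \<le> (K1 + K2) * norm v"
      using K1(2)[of v] K2(2)[of v] by (auto simp: algebra_simps)
  qed (use K1 K2 in auto)
qed

lemma bounded_coords: "bounded {x. \<bar>P x\<bar> \<le> 2 \<and> \<bar>Q x\<bar> \<le> 2}"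
proof -
  have "norm x \<le> sqrt (c * 16)" if "\<bar>P x\<bar> \<le> 2" "\<bar>Q x\<bar> \<le> 2" for x
  proof -
    have "(P x)\<^sup>2 \<le> 2\<^sup>2" "(Q x)\<^sup>2 \<le> 2\<^sup>2" using that abs_le_square_iff[of _ 2] by force+
    then have "c * (P x * P x + 3 * Q x * Q x) \<le> c * 16"
      using c by (intro mult_left_mono) (auto simp: power2_eq_square)
    then show ?thesis unfolding norm_eq_sqrt_inner inner_eq by (rule real_sqrt_le_mono)
  qed
  then show ?thesis unfolding bounded_iff by blast
qed

lemma closed_periodic:
  assumes "closed K" "K \<subseteq> {x. \<bar>P x\<bar> \<le> 2 \<and> \<bar>Q x\<bar> \<le> 2}"
  shows "closed (K + dual_lattice Lam)"
proof -
  have "compact K" using assms bounded_coords bounded_subset compact_eq_bounded_closed by blast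
  then show ?thesis using closed_plus_compact[OF closed_dual_lattice] by (metis add.commute)
qed

lemma mem_periodic:
  "x \<in> {x. R (P x) (Q x)} + dual_lattice Lam \<longleftrightarrow> (\<exists>a b. hex_lattice a b \<and> R (P x - a) (Q x - b))"
proof
  assume "x \<in> {x. R (P x) (Q x)} + dual_lattice Lam"
  then show "\<exists>a b. hex_lattice a b \<and> R (P x - a) (Q x - b)"
  proof (rule set_plus_elim)
    fix k l assume "x = k + l" "k \<in> {x. R (P x) (Q x)}" "l \<in> dual_lattice Lam"
    then show ?thesis by (intro exI[of _ "P l"] exI[of _ "Q l"]) (auto simp: dual_Lam)
  qed
next
  assume "\<exists>a b. hex_lattice a b \<and> R (P x - a) (Q x - b)"
  then obtain a b where ab: "hex_lattice a b" "R (P x - a) (Q x - b)" by blast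
  obtain l where "P l = a" "Q l = b" using surj by blast
  then have "x - l \<in> {x. R (P x) (Q x)}" "l \<in> dual_lattice Lam" using ab by (auto simp: dual_Lam)
  from set_plus_intro[OF this] show "x \<in> {x. R (P x) (Q x)} + dual_lattice Lam" by simp
qed

text \<open>One short segment inside the set supplies a tangent direction, turning normality into a
  linear equation in the coordinates.\<close>

lemma normal_at_ray:
  assumes "normal_at B x v" "P d = a" "Q d = b" "\<tau>0 > 0"
    "\<And>\<tau>. 0 < \<tau> \<Longrightarrow> \<tau> < \<tau>0 \<Longrightarrow> x + \<tau> *\<^sub>R d \<in> B"
  shows "P v * a + 3 * Q v * b = 0"
proof -
  have "orthogonal v d"
    using assms tangent_cone_ray[of \<tau>0 x d B] unfolding normal_at_def by blast
  then show ?thesis using c assms(2,3) by (simp add: orthogonal_def inner_eq)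
qed

end

section \<open>Tilings by trapezoids\<close>

text \<open>\<open>A\<close> stands for \<open>calA k\<close> and \<open>G\<close> for the dual of
  \<open>Gam k\<close>. The strict inequality reflects that the edge \<open>p = 1\<close> belongs to
  \<open>A0\<close>.\<close>

locale trap_frame = hex_frame +
  fixes A G :: "(real^2) set"
  assumes A_iff: "x \<in> A \<longleftrightarrow> (\<exists>a b. hex_lattice a b \<and>
      (\<exists>s\<in>{1,-1}. trap (s * (P x - a)) (s * (Q x - b)) \<and> 1 < s * (P x - a)))"
    and G_iff: "\<gamma> \<in> G \<longleftrightarrow> P \<gamma> \<in> \<int> \<and> Q \<gamma> \<in> \<int>"
begin

definition core :: "(real^2) set" where
  "core = {x. \<exists>a b. hex_lattice a b \<and> (\<exists>s\<in>{1,-1}. open_trap (s * (P x - a)) (s * (Q x - b)))}"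

lemma closed_traps: "closed {x. traps (P x) (Q x)}"
proof -
  let ?R = "\<lambda>p q. \<exists>s\<in>{1,-1}. trap (s * p) (s * q)"
  have "closed {x. ?R (P x) (Q x)}"
    unfolding trap_def
    by (simp, intro closed_Collect_disj closed_Collect_conj closed_Collect_le continuous_intros)
  moreover have "{x. ?R (P x) (Q x)} \<subseteq> {x. \<bar>P x\<bar> \<le> 2 \<and> \<bar>Q x\<bar> \<le> 2}"
    unfolding trap_def by auto
  ultimately have "closed ({x. ?R (P x) (Q x)} + dual_lattice Lam)" by (rule closed_periodic)
  moreover have "{x. ?R (P x) (Q x)} + dual_lattice Lam = {x. traps (P x) (Q x)}"
    by (rule set_eqI) (simp only: mem_periodic[of _ ?R] traps_def mem_Collect_eq)
  ultimately show ?thesis by simp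
qed

lemma traps_closure_core: "traps (P x) (Q x) \<Longrightarrow> x \<in> closure core"
proof -
  assume "traps (P x) (Q x)"
  then obtain a b s where ab: "hex_lattice a b" "s \<in> {1,-1}" and t: "trap (s * (P x - a)) (s * (Q x - b))"
    unfolding traps_def by blast
  obtain d where d: "P d = s * (3/2 - s * (P x - a))" "Q d = s * (1/4 - s * (Q x - b))"
    using surj by blast
  show ?thesis
  proof (rule in_closure_ray[of _ d])
    fix \<tau> :: real assume \<tau>: "0 < \<tau>" "\<tau> < 1"
    have "s * (P (x + \<tau> *\<^sub>R d) - a) = s * (P x - a) + \<tau> * (3/2 - s * (P x - a))"
      "s * (Q (x + \<tau> *\<^sub>R d) - b) = s * (Q x - b) + \<tau> * (1/4 - s * (Q x - b))"
      using ab(2) by (auto simp: d algebra_simps)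
    then have "open_trap (s * (P (x + \<tau> *\<^sub>R d) - a)) (s * (Q (x + \<tau> *\<^sub>R d) - b))"
      using trap_shrink[OF t \<tau>] by simp
    then show "x + \<tau> *\<^sub>R d \<in> core" using ab unfolding core_def by blast
  qed
qed

lemma core_subset: "core \<subseteq> A"
proof -
  have "trap p q \<and> 1 < p" if "open_trap p q" for p q using that by (simp add: open_trap_def trap_def)
  then show ?thesis unfolding core_def A_iff subset_iff mem_Collect_eq by blast
qed

text \<open>\<open>A\<close> lies between the union of the open tiles and that of the closed tiles,
  and the former is dense in the latter.\<close>

lemma closure_A: "closure A = {x. traps (P x) (Q x)}"
proof
  have "A \<subseteq> {x. traps (P x) (Q x)}" unfolding A_iff traps_def subset_iff mem_Collect_eq by blast
  then show "closure A \<subseteq> {x. traps (P x) (Q x)}" using closed_traps by (rule closure_minimal)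
  show "{x. traps (P x) (Q x)} \<subseteq> closure A"
    using traps_closure_core closure_mono[OF core_subset] by auto
qed

lemma in_frontier_A:
  assumes \<gamma>: "\<gamma> \<in> G" "\<gamma> \<notin> dual_lattice Lam" and x: "traps (P x) (Q x)" "traps (P (x + \<gamma>)) (Q (x + \<gamma>))"
  shows "x \<in> frontier A"
proof (rule frontier_of_packing[OF closure_A, of core \<gamma>])
  show "{x. traps (P x) (Q x)} \<subseteq> closure core" using traps_closure_core by blast
  fix z assume "z \<in> core"
  then obtain a b s where ab: "hex_lattice a b" "s \<in> {1,-1}" and t: "open_trap (s * (P z - a)) (s * (Q z - b))"
    unfolding core_def by blast
  show "z - \<gamma> \<notin> {x. traps (P x) (Q x)}"
  proof
    assume "z - \<gamma> \<in> {x. traps (P x) (Q x)}"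
    \<comment> \<open>A lattice translation and the sign \<open>s\<close> move the tile of
      \<open>z\<close> to the standard trapezoid, where \<open>open_trap_packing\<close>
      applies.\<close>
    then have "traps (P z - P \<gamma> + - a) (Q z - Q \<gamma> + - b)"
      using ab by (subst traps_translate) auto
    then have "traps (s * (P z - P \<gamma> + - a)) (s * (Q z - Q \<gamma> + - b))"
      using traps_scale[OF ab(2)] by blast
    then have "traps (s * (P z - a) - s * P \<gamma>) (s * (Q z - b) - s * Q \<gamma>)"
      by (simp add: algebra_simps)
    moreover have "s * P \<gamma> \<in> \<int>" "s * Q \<gamma> \<in> \<int>" using \<gamma>(1) ab(2) by (auto simp: G_iff)
    then obtain C D where "s * P \<gamma> = of_int C" "s * Q \<gamma> = of_int D" by (auto elim!: Ints_cases)
    ultimately have "hex_lattice (s * P \<gamma>) (s * Q \<gamma>)" using open_trap_packing[OF t] by simp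
    then show False using hex_lattice_scale[OF ab(2)] \<gamma>(2) by (auto simp: dual_Lam)
  qed
qed (use x in auto)

text \<open>The neighbour across the edge yields a shift in \<open>G\<close> outside the dual of
  \<open>Lam\<close> to which the packing argument applies. Having whole edges in the frontier gives
  the tangent cone enough directions.\<close>

lemma edge_in_frontier:
  assumes ab: "hex_lattice a b" "s \<in> {1,-1}" and pq: "s * (P x - a) = p" "s * (Q x - b) = q"
    and t: "trap p q" and e: "q = 0 \<or> 3 * q = p \<or> p = 1 \<or> p = 2"
  shows "x \<in> frontier A"
proof -
  obtain C D :: int where CD: "\<not> hex_lattice (of_int C) (of_int D)" "traps (p + of_int C) (q + of_int D)"
    using trap_edge_neighbour[OF t e] .
  obtain \<gamma> where \<gamma>: "P \<gamma> = s * of_int C" "Q \<gamma> = s * of_int D" using surj by blast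
  have in_traps: "traps (P y) (Q y)" if "traps (s * (P y - a)) (s * (Q y - b))" for y
  proof -
    have "traps (P y + - a) (Q y + - b)" using that traps_scale[OF ab(2), of "P y - a" "Q y - b"] by simp
    then show ?thesis using ab(1) by (subst (asm) traps_translate) auto
  qed
  have "s * (P (x + \<gamma>) - a) = p + of_int C" "s * (Q (x + \<gamma>) - b) = q + of_int D"
    using pq ab(2) by (auto simp: \<gamma> algebra_simps)
  then have "traps (P (x + \<gamma>)) (Q (x + \<gamma>))" using CD(2) by (intro in_traps) simp
  moreover have "traps (P x) (Q x)" using t pq by (intro in_traps) (simp add: trap_imp_traps)
  moreover have "\<gamma> \<in> G" using ab(2) by (auto simp: G_iff \<gamma>)
  moreover have "\<gamma> \<notin> dual_lattice Lam" using CD(1) hex_lattice_scale[OF ab(2)] by (simp add: dual_Lam \<gamma>)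
  ultimately show ?thesis using in_frontier_A by blast
qed

text \<open>From any edge point one can move along the edge in at least one direction without
  leaving it. Corners lie on two edges, so both equations hold there and only the zero vector is
  normal.\<close>

lemma normal_at_edges:
  assumes ab: "hex_lattice a b" "s \<in> {1,-1}" and pq: "s * (P x - a) = p" "s * (Q x - b) = q"
    and t: "trap p q" and n: "normal_at (frontier A) x v"
  shows "q = 0 \<Longrightarrow> s * P v = 0" "3 * q = p \<Longrightarrow> s * Q v = - (s * P v)"
    "p = 1 \<or> p = 2 \<Longrightarrow> s * Q v = 0"
proof -
  have ray: "s * P v * dp + 3 * (s * Q v) * dq = 0"
    if "\<tau>0 > 0" and r: "\<And>\<tau>. 0 < \<tau> \<Longrightarrow> \<tau> < \<tau>0 \<Longrightarrow> trap (p + \<tau> * dp) (q + \<tau> * dq) \<and>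
        (q + \<tau> * dq = 0 \<or> 3 * (q + \<tau> * dq) = p + \<tau> * dp \<or> p + \<tau> * dp = 1 \<or> p + \<tau> * dp = 2)"
    for \<tau>0 dp dq
  proof -
    obtain d where d: "P d = s * dp" "Q d = s * dq" using surj by blast
    have "x + \<tau> *\<^sub>R d \<in> frontier A" if "0 < \<tau>" "\<tau> < \<tau>0" for \<tau>
    proof (rule edge_in_frontier[OF ab])
      show "s * (P (x + \<tau> *\<^sub>R d) - a) = p + \<tau> * dp" "s * (Q (x + \<tau> *\<^sub>R d) - b) = q + \<tau> * dq"
        using pq ab(2) by (auto simp: d algebra_simps)
    qed (use r[OF that] in auto)
    from normal_at_ray[OF n d \<open>\<tau>0 > 0\<close> this] show ?thesis by (simp add: algebra_simps)
  qed
  show "s * P v = 0" if "q = 0"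
  proof (cases "p < 2")
    case True
    then show ?thesis using ray[of "2 - p" 1 0] t that by (simp add: trap_def)
  next
    case False
    then show ?thesis using ray[of 1 "-1" 0] t that by (simp add: trap_def)
  qed
  show "s * Q v = - (s * P v)" if "3 * q = p"
  proof (cases "p < 2")
    case True
    then show ?thesis using ray[of "(2 - p) / 3" 3 1] t that by (simp add: trap_def)
  next
    case False
    then show ?thesis using ray[of "1/3" "-3" "-1"] t that by (simp add: trap_def)
  qed
  show "s * Q v = 0" if "p = 1 \<or> p = 2"
  proof (cases "3 * q < p")
    case True
    then show ?thesis using ray[of "(p - 3 * q) / 3" 0 1] t that by (simp add: trap_def)
  next
    case False
    then show ?thesis using ray[of q 0 "-1"] t that by (simp add: trap_def)
  qed
qed

text \<open>Reduces to \<open>trap_cover\<close> by placing the tiles of \<open>x\<close> and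
  \<open>x + \<gamma>\<close> in standard position; their relative offset is integral because
  \<open>\<gamma> \<in> G\<close>. The hypothesis \<open>mirror\<close> serves to exclude the
  T-junction.\<close>

lemma local_cover:
  assumes \<gamma>: "\<gamma> \<in> G" "\<gamma> \<notin> dual_lattice Lam" and x: "x \<in> closure A" "x + \<gamma> \<in> closure A"
    and mirror: "\<not> (traps (P x) (- Q x) \<and> traps (P (x + \<gamma>)) (- Q (x + \<gamma>)))"
  obtains \<delta> where "\<delta> > 0" "\<And>y. norm (y - x) < \<delta> \<Longrightarrow> y \<noteq> x \<Longrightarrow>
    normal_at (frontier A) x (y - x) \<Longrightarrow> y \<in> closure A \<or> y + \<gamma> \<in> closure A"
proof -
  obtain a b s where ab: "hex_lattice a b" "s \<in> {1,-1}" and t: "trap (s * (P x - a)) (s * (Q x - b))"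
    using x(1) unfolding closure_A traps_def by blast
  obtain a' b' s' where ab': "hex_lattice a' b'" "s' \<in> {1,-1}"
    and t': "trap (s' * (P (x + \<gamma>) - a')) (s' * (Q (x + \<gamma>) - b'))"
    using x(2) unfolding closure_A traps_def by blast
  define p q p' q' \<sigma> where pq_def: "p = s * (P x - a)" "q = s * (Q x - b)"
    "p' = s' * (P (x + \<gamma>) - a')" "q' = s' * (Q (x + \<gamma>) - b')" "\<sigma> = s * s'"
  note t = t[folded pq_def] and t' = t'[folded pq_def]
  have \<sigma>: "\<sigma> = 1 \<or> \<sigma> = -1" using ab(2) ab'(2) by (auto simp: pq_def)
  have dp: "p - \<sigma> * p' = s * (a' - a - P \<gamma>)" and dq: "q - \<sigma> * q' = s * (b' - b - Q \<gamma>)"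
    using ab(2) ab'(2) by (auto simp: pq_def algebra_simps)
  have int: "a \<in> \<int>" "b \<in> \<int>" if "hex_lattice a b" for a b
    using that unfolding hex_lattice_def by auto
  have "s * (a' - a - P \<gamma>) \<in> \<int>" "s * (b' - b - Q \<gamma>) \<in> \<int>"
    using int[OF ab(1)] int[OF ab'(1)] \<gamma>(1) ab(2) by (auto simp: G_iff)
  then obtain C D where CD: "p - \<sigma> * p' = of_int C" "q - \<sigma> * q' = of_int D"
    unfolding dp dq by (auto elim!: Ints_cases)
  have ne: "\<not> (C = 0 \<and> D = 0)"
  proof
    assume "C = 0 \<and> D = 0"
    then have "P \<gamma> = a' - a" "Q \<gamma> = b' - b" using CD dp dq ab(2) by auto
    then show False using \<gamma>(2) hex_lattice_diff[OF ab'(1) ab(1)] by (simp add: dual_Lam)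
  qed
  have bad: "\<not> (\<sigma> = -1 \<and> p = 2 \<and> q = 1/3 \<and> p' = 2 \<and> q' = 2/3)"
  proof
    assume bad: "\<sigma> = -1 \<and> p = 2 \<and> q = 1/3 \<and> p' = 2 \<and> q' = 2/3"
    have flip: "traps u (- w)" if ab: "hex_lattice a b" "s \<in> {1,-1}" and "traps (s * (u - a)) (- (s * (w - b)))" for u w a b s
    proof -
      have "traps (u + - a) (- w + - (- b))"
        using that(3) traps_scale[OF ab(2), of "u - a" "b - w"] by (simp add: algebra_simps)
      moreover have "hex_lattice (- a) (- (- b))"
        using ab(1) hex_lattice_minus_iff[of a "- b"] hex_lattice_reflect[of a b] by simp
      ultimately show ?thesis by (subst (asm) traps_translate) auto
    qed
    \<comment> \<open>A half turn followed by the lattice shift (4, 0) preserves the tiling and acts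
      on the line \<open>p = 2\<close> as \<open>q\<close> to \<open>-q\<close>. Both contact points
      lie on that edge, so both also lie in the mirror tiling.\<close>
    have "hex_lattice (-4) 0" using hex_lattice_of_int[of "-4" 0] by simp
    then have "traps 2 (- w)" if "trap 2 w" for w
      using traps_translate[of "-4" 0 2 "- w"] trap_imp_traps[OF that] traps_minus[of 2 w] by simp
    from this[of "1/3"] this[of "2/3"] have "traps 2 (- (1/3))" "traps 2 (- (2/3))"
      by (simp_all add: trap_def)
    then have "traps p (- q)" "traps p' (- q')" using bad by metis+
    then have "traps (P x) (- Q x)" "traps (P (x + \<gamma>)) (- Q (x + \<gamma>))"
      using flip[OF ab, of "P x" "Q x"] flip[OF ab', of "P (x + \<gamma>)" "Q (x + \<gamma>)"]
      unfolding pq_def by blast+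
    then show False using mirror by blast
  qed
  let ?Z = "{p - 1, 2 - p, q, p - 3 * q, p' - 1, 2 - p', q', p' - 3 * q'}"
  obtain \<delta> where \<delta>: "\<delta> > 0" "\<And>z. z \<in> ?Z \<Longrightarrow> z = 0 \<or> 4 * \<delta> \<le> z"
  proof (rule common_slack)
    show "0 \<le> z" if "z \<in> ?Z" for z using that t t' unfolding trap_def by auto
  qed auto
  have sl1: "p = 1 \<or> p \<ge> 1 + 4*\<delta>" using \<delta>(2)[of "p - 1"] by auto
  have sl2: "p = 2 \<or> p \<le> 2 - 4*\<delta>" using \<delta>(2)[of "2 - p"] by auto
  have sl3: "q = 0 \<or> q \<ge> 4*\<delta>" using \<delta>(2)[of "q"] by auto
  have sl4: "3*q = p \<or> 3*q \<le> p - 4*\<delta>" using \<delta>(2)[of "p - 3 * q"] by auto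
  have sl5: "p' = 1 \<or> p' \<ge> 1 + 4*\<delta>" using \<delta>(2)[of "p' - 1"] by auto
  have sl6: "p' = 2 \<or> p' \<le> 2 - 4*\<delta>" using \<delta>(2)[of "2 - p'"] by auto
  have sl7: "q' = 0 \<or> q' \<ge> 4*\<delta>" using \<delta>(2)[of "q'"] by auto
  have sl8: "3*q' = p' \<or> 3*q' \<le> p' - 4*\<delta>" using \<delta>(2)[of "p' - 3 * q'"] by auto
  note sl = sl1 sl2 sl3 sl4 sl5 sl6 sl7 sl8
  obtain K where K: "K > 0" "\<And>v. \<bar>P v\<bar> \<le> K * norm v" "\<And>v. \<bar>Q v\<bar> \<le> K * norm v"
    using coords_bounded by blast
  show ?thesis
  proof (rule that[of "\<delta> / K"])
    fix y assume y: "norm (y - x) < \<delta> / K" "y \<noteq> x" "normal_at (frontier A) x (y - x)"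
    define v z where vz: "v = s * P (y - x)" "z = s * Q (y - x)"
    have "K * norm (y - x) < \<delta>" using y(1) K(1) by (simp add: field_simps)
    then have "\<bar>P (y - x)\<bar> \<le> \<delta>" "\<bar>Q (y - x)\<bar> \<le> \<delta>"
      using K(2)[of "y - x"] K(3)[of "y - x"] by linarith+
    then have small: "\<bar>v\<bar> \<le> \<delta>" "\<bar>z\<bar> \<le> \<delta>" using ab(2) by (auto simp: vz simp del: coord_simps)
    have v0: "v \<noteq> 0 \<or> z \<noteq> 0" using y(2) ab(2) coord_eqI[of y x] by (auto simp: vz)
    have "trap (p + v) (q + z) \<or> trap (p' + \<sigma> * v) (q' + \<sigma> * z)"
      using normal_at_edges[OF ab pq_def(1,2)[symmetric] t y(3), folded vz]
      by (intro trap_cover[OF t t' \<sigma> CD ne bad v0 small sl]) auto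
    moreover have "p + v = s * (P y - a)" "q + z = s * (Q y - b)"
      "p' + \<sigma> * v = s' * (P (y + \<gamma>) - a')" "q' + \<sigma> * z = s' * (Q (y + \<gamma>) - b')"
      using ab(2) by (auto simp: pq_def vz algebra_simps)
    ultimately show "y \<in> closure A \<or> y + \<gamma> \<in> closure A"
      using ab ab' unfolding closure_A traps_def by auto
  qed (use \<delta> K in auto)
qed

end

section \<open>The tiling by hexagons\<close>

definition hexagons :: "real \<Rightarrow> real \<Rightarrow> bool" where
  "hexagons p q \<longleftrightarrow> (\<exists>a b. hex_lattice a b \<and> hexagon (p - a) (q - b))"

definition open_hexagon :: "real \<Rightarrow> real \<Rightarrow> bool" where
  "open_hexagon p q \<longleftrightarrow> \<bar>p\<bar> < 1 \<and> \<bar>p + 3 * q\<bar> < 2 \<and> \<bar>p - 3 * q\<bar> < 2"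

lemma half_hex_lattice:
  assumes "hex_lattice (2 * x) (2 * y)"
  obtains C D :: int where "even (C + D)" "x = of_int C" "y = of_int D"
  using assms unfolding hex_lattice_def by force

text \<open>The bounds leave only the offsets (\<plusminus>1, \<plusminus>1) besides zero, and these
  are separated by the slanted sides.\<close>

lemma open_hexagon_packing:
  assumes pq: "open_hexagon p q" and h: "hexagon (p - c) (q - d)" and "hex_lattice (2 * c) (2 * d)"
  shows "c = 0 \<and> d = 0"
proof -
  obtain C D :: int where CD: "even (C + D)" "c = of_int C" "d = of_int D"
    using half_hex_lattice[OF assms(3)] .
  have "-2 < C \<and> C < 2" using pq h unfolding open_hexagon_def hexagon_def CD
    by (intro int_between; simp; linarith)
  moreover have "-2 < D \<and> D < 2" using pq h unfolding open_hexagon_def hexagon_def CD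
    by (intro int_between; simp; linarith)
  ultimately have "C \<in> {-1,0,1}" "D \<in> {-1,0,1}" by auto
  then consider "C = 0" "D = 0" | "C = 1" "D = 1" | "C = 1" "D = -1" | "C = -1" "D = 1" | "C = -1" "D = -1"
    using CD(1) by auto
  then show ?thesis
    using pq h unfolding open_hexagon_def hexagon_def CD by cases (simp; linarith)+
qed

lemma hexagon_shrink:
  assumes "hexagon p q" "0 < \<tau>" "\<tau> < 1"
  shows "open_hexagon (p - \<tau> * p) (q - \<tau> * q)"
proof -
  have *: "\<bar>u - \<tau> * u\<bar> < k" if "\<bar>u\<bar> \<le> k" "k > 0" for u k :: real
  proof -
    have "\<bar>u - \<tau> * u\<bar> = (1 - \<tau>) * \<bar>u\<bar>"
      using abs_mult[of "1 - \<tau>" u] assms by (simp add: left_diff_distrib)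
    also have "\<dots> \<le> (1 - \<tau>) * k" using assms that by (intro mult_left_mono) auto
    also have "\<dots> < k" using mult_strict_right_mono[of "1 - \<tau>" 1 k] assms that by simp
    finally show ?thesis .
  qed
  show ?thesis
    using *[of p 1] *[of "p + 3 * q" 2] *[of "p - 3 * q" 2] assms(1)
    unfolding open_hexagon_def hexagon_def by (simp add: algebra_simps)
qed

lemma hexagon_edge_neighbour:
  assumes t: "hexagon p q" and e: "\<bar>p\<bar> = 1 \<or> \<bar>p + 3 * q\<bar> = 2 \<or> \<bar>p - 3 * q\<bar> = 2"
  obtains C D :: int where "even (C + D)" "\<not> hex_lattice (of_int C) (of_int D)"
    "hexagon (p + of_int C) (q + of_int D)"
proof -
  consider "p = 1" | "p = -1" | "p + 3 * q = 2" | "p + 3 * q = -2" | "p - 3 * q = 2" | "p - 3 * q = -2"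
    using e by argo
  then show ?thesis
  proof cases
    case 1 then show ?thesis using t hex_lattice_of_int[of "-2" 0]
      by (intro that[of "-2" 0]) (auto simp: hexagon_def)
  next
    case 2 then show ?thesis using t hex_lattice_of_int[of 2 0]
      by (intro that[of 2 0]) (auto simp: hexagon_def)
  next
    case 3 then show ?thesis using t hex_lattice_of_int[of "-1" "-1"]
      by (intro that[of "-1" "-1"]) (auto simp: hexagon_def)
  next
    case 4 then show ?thesis using t hex_lattice_of_int[of 1 1]
      by (intro that[of 1 1]) (auto simp: hexagon_def)
  next
    case 5 then show ?thesis using t hex_lattice_of_int[of "-1" 1]
      by (intro that[of "-1" 1]) (auto simp: hexagon_def)
  next
    case 6 then show ?thesis using t hex_lattice_of_int[of 1 "-1"]
      by (intro that[of 1 "-1"]) (auto simp: hexagon_def)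
  qed
qed

text \<open>\<open>Gam 0\<close> is twice \<open>Lam\<close>, so membership in its dual says that
  the doubled vector lies in the dual of \<open>Lam\<close>.\<close>

locale hexagon_frame = hex_frame +
  fixes A G :: "(real^2) set"
  assumes A_iff: "x \<in> A \<longleftrightarrow> hexagons (P x) (Q x)"
    and G_iff: "\<gamma> \<in> G \<longleftrightarrow> hex_lattice (2 * P \<gamma>) (2 * Q \<gamma>)"
begin

definition core :: "(real^2) set" where
  "core = {x. \<exists>a b. hex_lattice a b \<and> open_hexagon (P x - a) (Q x - b)}"

lemma closure_A: "closure A = A"
proof -
  have "closed {x. hexagon (P x) (Q x)}"
    unfolding hexagon_def
    by (intro closed_Collect_conj closed_Collect_le continuous_intros)
  moreover have "{x. hexagon (P x) (Q x)} \<subseteq> {x. \<bar>P x\<bar> \<le> 2 \<and> \<bar>Q x\<bar> \<le> 2}"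
    unfolding hexagon_def by auto
  ultimately have "closed ({x. hexagon (P x) (Q x)} + dual_lattice Lam)" by (rule closed_periodic)
  moreover have "{x. hexagon (P x) (Q x)} + dual_lattice Lam = A"
    by (rule set_eqI) (simp only: mem_periodic[of _ hexagon] hexagons_def A_iff)
  ultimately show ?thesis by simp
qed

lemma A_subset_closure_core: "A \<subseteq> closure core"
proof
  fix x assume "x \<in> A"
  then obtain a b where ab: "hex_lattice a b" and t: "hexagon (P x - a) (Q x - b)"
    unfolding A_iff hexagons_def by blast
  obtain d where d: "P d = - (P x - a)" "Q d = - (Q x - b)" using surj by blast
  show "x \<in> closure core"
  proof (rule in_closure_ray[of _ d])
    fix \<tau> :: real assume \<tau>: "0 < \<tau>" "\<tau> < 1"
    have "open_hexagon (P (x + \<tau> *\<^sub>R d) - a) (Q (x + \<tau> *\<^sub>R d) - b)"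
      using hexagon_shrink[OF t \<tau>] by (simp add: d algebra_simps)
    then show "x + \<tau> *\<^sub>R d \<in> core" using ab unfolding core_def by blast
  qed
qed

lemma in_frontier_A:
  assumes \<gamma>: "\<gamma> \<in> G" "\<gamma> \<notin> dual_lattice Lam" and x: "x \<in> A" "x + \<gamma> \<in> A"
  shows "x \<in> frontier A"
proof (rule frontier_of_packing[OF closure_A A_subset_closure_core])
  fix z assume "z \<in> core"
  then obtain a b where ab: "hex_lattice a b" and t: "open_hexagon (P z - a) (Q z - b)"
    unfolding core_def by blast
  show "z - \<gamma> \<notin> A"
  proof
    assume "z - \<gamma> \<in> A"
    then obtain a' b' where ab': "hex_lattice a' b'" and t': "hexagon (P z - P \<gamma> - a') (Q z - Q \<gamma> - b')"
      unfolding A_iff hexagons_def by auto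
    have "hex_lattice (2 * (P \<gamma> + (a' - a))) (2 * (Q \<gamma> + (b' - b)))"
    proof -
      have d: "hex_lattice (a' - a) (b' - b)" using ab' ab by (intro hex_lattice_diff)
      from hex_lattice_add[OF hex_lattice_add[OF d d] \<gamma>(1)[unfolded G_iff]] show ?thesis
        by (simp add: algebra_simps)
    qed
    then have "P \<gamma> + (a' - a) = 0 \<and> Q \<gamma> + (b' - b) = 0"
      using open_hexagon_packing[OF t, of "P \<gamma> + (a' - a)" "Q \<gamma> + (b' - b)"] t' by (simp add: algebra_simps)
    then have "P \<gamma> = a - a'" "Q \<gamma> = b - b'" by auto
    then show False using \<gamma>(2) hex_lattice_diff[OF ab ab'] by (simp add: dual_Lam)
  qed
qed (use x in auto)

lemma edge_in_frontier:
  assumes ab: "hex_lattice a b" and pq: "P x - a = p" "Q x - b = q"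
    and t: "hexagon p q" and e: "\<bar>p\<bar> = 1 \<or> \<bar>p + 3 * q\<bar> = 2 \<or> \<bar>p - 3 * q\<bar> = 2"
  shows "x \<in> frontier A"
proof -
  obtain C D :: int where CD: "even (C + D)" "\<not> hex_lattice (of_int C) (of_int D)"
    "hexagon (p + of_int C) (q + of_int D)"
    using hexagon_edge_neighbour[OF t e] .
  obtain \<gamma> where \<gamma>: "P \<gamma> = of_int C" "Q \<gamma> = of_int D" using surj by blast
  have "hexagon (P (x + \<gamma>) - a) (Q (x + \<gamma>) - b)"
    using CD(3) by (simp add: \<gamma> algebra_simps flip: pq)
  then have "x + \<gamma> \<in> A" using ab unfolding A_iff hexagons_def by blast
  moreover have "x \<in> A" using ab t pq unfolding A_iff hexagons_def by blast
  moreover have "\<gamma> \<in> G" using CD(1) unfolding G_iff hex_lattice_def by (auto simp: \<gamma>)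
  moreover have "\<gamma> \<notin> dual_lattice Lam" using CD(2) by (simp add: dual_Lam \<gamma>)
  ultimately show ?thesis using in_frontier_A by blast
qed

lemma normal_at_edges:
  assumes ab: "hex_lattice a b" and pq: "P x - a = p" "Q x - b = q"
    and t: "hexagon p q" and n: "normal_at (frontier A) x v"
  shows "\<bar>p\<bar> = 1 \<Longrightarrow> Q v = 0" "\<bar>p + 3 * q\<bar> = 2 \<Longrightarrow> Q v = P v" "\<bar>p - 3 * q\<bar> = 2 \<Longrightarrow> Q v = - P v"
proof -
  have ray: "P v * dp + 3 * Q v * dq = 0"
    if "\<tau>0 > 0" and r: "\<And>\<tau>. 0 < \<tau> \<Longrightarrow> \<tau> < \<tau>0 \<Longrightarrow> hexagon (p + \<tau> * dp) (q + \<tau> * dq) \<and>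
        (\<bar>p + \<tau> * dp\<bar> = 1 \<or> \<bar>p + \<tau> * dp + 3 * (q + \<tau> * dq)\<bar> = 2 \<or> \<bar>p + \<tau> * dp - 3 * (q + \<tau> * dq)\<bar> = 2)"
    for \<tau>0 dp dq
  proof -
    obtain d where d: "P d = dp" "Q d = dq" using surj by blast
    have "x + \<tau> *\<^sub>R d \<in> frontier A" if "0 < \<tau>" "\<tau> < \<tau>0" for \<tau>
    proof (rule edge_in_frontier[OF ab])
      show "P (x + \<tau> *\<^sub>R d) - a = p + \<tau> * dp" "Q (x + \<tau> *\<^sub>R d) - b = q + \<tau> * dq"
        using pq by (auto simp: d algebra_simps)
    qed (use r[OF that] in auto)
    from normal_at_ray[OF n d \<open>\<tau>0 > 0\<close> this] show ?thesis .
  qed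
  show "Q v = 0" if "\<bar>p\<bar> = 1"
  \<comment> \<open>Each case split compares the point with the midpoint of its edge; moving away
    from the nearer end stays on the edge for parameters below 1/6.\<close>
  proof (cases "q \<ge> 0")
    case True
    have "P v * 0 + 3 * Q v * (-1) = 0"
      by (rule ray[of "1/6"], simp, use t that True in \<open>simp add: hexagon_def; linarith\<close>)
    then show ?thesis by simp
  next
    case False
    have "P v * 0 + 3 * Q v * 1 = 0"
      by (rule ray[of "1/6"], simp, use t that False in \<open>simp add: hexagon_def; linarith\<close>)
    then show ?thesis by simp
  qed
  show "Q v = P v" if "\<bar>p + 3 * q\<bar> = 2"
  proof (cases "p - q \<ge> 0")
    case True
    have "P v * (-3) + 3 * Q v * 1 = 0"
      by (rule ray[of "1/6"], simp, use t that True in \<open>simp add: hexagon_def; linarith\<close>)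
    then show ?thesis by simp
  next
    case False
    have "P v * 3 + 3 * Q v * (-1) = 0"
      by (rule ray[of "1/6"], simp, use t that False in \<open>simp add: hexagon_def; linarith\<close>)
    then show ?thesis by simp
  qed
  show "Q v = - P v" if "\<bar>p - 3 * q\<bar> = 2"
  proof (cases "p + q \<ge> 0")
    case True
    have "P v * (-3) + 3 * Q v * (-1) = 0"
      by (rule ray[of "1/6"], simp, use t that True in \<open>simp add: hexagon_def; linarith\<close>)
    then show ?thesis by simp
  next
    case False
    have "P v * 3 + 3 * Q v * 1 = 0"
      by (rule ray[of "1/6"], simp, use t that False in \<open>simp add: hexagon_def; linarith\<close>)
    then show ?thesis by simp
  qed
qed

lemma local_cover:
  assumes \<gamma>: "\<gamma> \<in> G" "\<gamma> \<notin> dual_lattice Lam" and x: "x \<in> closure A" "x + \<gamma> \<in> closure A"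
  obtains \<delta> where "\<delta> > 0" "\<And>y. norm (y - x) < \<delta> \<Longrightarrow> y \<noteq> x \<Longrightarrow>
    normal_at (frontier A) x (y - x) \<Longrightarrow> y \<in> closure A \<or> y + \<gamma> \<in> closure A"
proof -
  obtain a b where ab: "hex_lattice a b" and t: "hexagon (P x - a) (Q x - b)"
    using x(1) unfolding closure_A A_iff hexagons_def by blast
  obtain a' b' where ab': "hex_lattice a' b'"
    and t': "hexagon (P (x + \<gamma>) - a') (Q (x + \<gamma>) - b')"
    using x(2) unfolding closure_A A_iff hexagons_def by blast
  define p q where pq_def: "p = P x - a" "q = Q x - b"
  have "hex_lattice (2 * (P \<gamma> + (a - a'))) (2 * (Q \<gamma> + (b - b')))"
  proof -
    have d: "hex_lattice (a - a') (b - b')" using ab ab' by (intro hex_lattice_diff)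
    from hex_lattice_add[OF hex_lattice_add[OF d d] \<gamma>(1)[unfolded G_iff]] show ?thesis
      by (simp add: algebra_simps)
  qed
  then obtain C D :: int where ev: "even (C + D)" and CD: "P \<gamma> + (a - a') = of_int C" "Q \<gamma> + (b - b') = of_int D"
    using half_hex_lattice by blast
  have ne: "\<not> (C = 0 \<and> D = 0)"
  proof
    assume "C = 0 \<and> D = 0"
    then have "P \<gamma> = a' - a" "Q \<gamma> = b' - b" using CD by auto
    then show False using \<gamma>(2) hex_lattice_diff[OF ab' ab] by (simp add: dual_Lam)
  qed
  note t = t[folded pq_def]
  have t': "hexagon (p + of_int C) (q + of_int D)"
    using t' by (simp add: pq_def algebra_simps flip: CD)
  let ?Z = "{1 - \<bar>p\<bar>, 2 - \<bar>p + 3 * q\<bar>, 2 - \<bar>p - 3 * q\<bar>}"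
  obtain \<delta> where \<delta>: "\<delta> > 0" "\<And>z. z \<in> ?Z \<Longrightarrow> z = 0 \<or> 4 * \<delta> \<le> z"
  proof (rule common_slack)
    show "0 \<le> z" if "z \<in> ?Z" for z using that t unfolding hexagon_def by auto
  qed auto
  have sl: "\<bar>p\<bar> = 1 \<or> \<bar>p\<bar> \<le> 1 - 4*\<delta>" "\<bar>p + 3*q\<bar> = 2 \<or> \<bar>p + 3*q\<bar> \<le> 2 - 4*\<delta>"
      "\<bar>p - 3*q\<bar> = 2 \<or> \<bar>p - 3*q\<bar> \<le> 2 - 4*\<delta>"
    using \<delta>(2)[of "1 - \<bar>p\<bar>"] \<delta>(2)[of "2 - \<bar>p + 3 * q\<bar>"] \<delta>(2)[of "2 - \<bar>p - 3 * q\<bar>"] by auto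
  obtain K where K: "K > 0" "\<And>v. \<bar>P v\<bar> \<le> K * norm v" "\<And>v. \<bar>Q v\<bar> \<le> K * norm v"
    using coords_bounded by blast
  show ?thesis
  proof (rule that[of "\<delta> / K"])
    fix y assume y: "norm (y - x) < \<delta> / K" "y \<noteq> x" "normal_at (frontier A) x (y - x)"
    define v z where vz: "v = P (y - x)" "z = Q (y - x)"
    have "K * norm (y - x) < \<delta>" using y(1) K(1) by (simp add: field_simps)
    then have small: "\<bar>v\<bar> \<le> \<delta>" "\<bar>z\<bar> \<le> \<delta>"
      unfolding vz using K(2)[of "y - x"] K(3)[of "y - x"] by linarith+
    have v0: "v \<noteq> 0 \<or> z \<noteq> 0" using y(2) coord_eqI[of y x] by (auto simp: vz)
    have "hexagon (p + v) (q + z) \<or> hexagon (p + of_int C + v) (q + of_int D + z)"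
      using normal_at_edges[OF ab pq_def[symmetric] t y(3), folded vz]
      by (intro hexagon_cover[OF t t' ev ne v0 small sl]) auto
    moreover have "p + v = P y - a" "q + z = Q y - b"
      "p + of_int C + v = P (y + \<gamma>) - a'" "q + of_int D + z = Q (y + \<gamma>) - b'"
      by (auto simp: pq_def vz algebra_simps simp flip: CD)
    ultimately show "y \<in> closure A \<or> y + \<gamma> \<in> closure A"
      using ab ab' unfolding closure_A A_iff hexagons_def by metis
  qed (use \<delta> K in auto)
qed

end

section \<open>The coordinates of the frequency partition\<close>

text \<open>By integer linearity it suffices to test against the two generators, the columns
  (\<open>a\<close>, \<open>c\<close>) and (\<open>b\<close>, \<open>d\<close>).\<close>

lemma dual_lattice_of:
  "\<gamma> \<in> dual_lattice (lattice_of (vector [vector [a, b], vector [c, d]])) \<longleftrightarrow>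
    (a * \<gamma> $ 1 + c * \<gamma> $ 2) / (2 * pi) \<in> \<int> \<and> (b * \<gamma> $ 1 + d * \<gamma> $ 2) / (2 * pi) \<in> \<int>"
    (is "?L \<longleftrightarrow> ?A \<in> \<int> \<and> ?B \<in> \<int>")
proof -
  let ?M = "vector [vector [a, b], vector [c, d]] :: real^2^2"
  have eq: "(?M *v z) \<bullet> \<gamma> = 2 * pi * (z $ 1 * ?A + z $ 2 * ?B)" for z :: "real^2"
    by (simp add: matrix_vector_mult_def inner_vec_def sum_2 field_simps)
  have iff: "?L \<longleftrightarrow> (\<forall>z :: real^2. (\<forall>i. z $ i \<in> \<int>) \<longrightarrow> z $ 1 * ?A + z $ 2 * ?B \<in> \<int>)"
  proof -
    have "(\<exists>n::int. 2 * pi * u = 2 * pi * of_int n) \<longleftrightarrow> u \<in> \<int>" for u :: real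
      by (auto simp: Ints_def)
    then have "(\<exists>n::int. (?M *v z) \<bullet> \<gamma> = 2 * pi * of_int n) \<longleftrightarrow> z $ 1 * ?A + z $ 2 * ?B \<in> \<int>" for z
      unfolding eq .
    then show ?thesis unfolding dual_lattice_def lattice_of_def by blast
  qed
  show ?thesis
  proof
    assume "?L"
    then have *: "z $ 1 * ?A + z $ 2 * ?B \<in> \<int>" if "\<forall>i. z $ i \<in> \<int>" for z :: "real^2" using iff that by blast
    from *[of "vector [1, 0]"] *[of "vector [0, 1]"] show "?A \<in> \<int> \<and> ?B \<in> \<int>"
      by (simp add: forall_2)
  next
    assume "?A \<in> \<int> \<and> ?B \<in> \<int>"
    then show ?L unfolding iff by (intro allI impI Ints_add Ints_mult) auto
  qed
qed

text \<open>The chosen side of the wedge is perpendicular to a side of \<open>hexS\<close>, so the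
  two straight cuts become \<open>p = 1\<close> and \<open>p = 2\<close>.\<close>

definition axis_angle :: "nat \<Rightarrow> real" where
  "axis_angle k = (if k = 3 \<or> k = 4 then - (pi / 3) else if k = 5 \<or> k = 6 then pi / 3 else 0)"

definition orient :: "nat \<Rightarrow> real" where
  "orient k = (if odd k then 1 else -1)"

definition coordP :: "nat \<Rightarrow> real^2 \<Rightarrow> real" where
  "coordP k x = 2 / pi * (x $ 1 * cos (axis_angle k) + x $ 2 * sin (axis_angle k))"

definition coordQ :: "nat \<Rightarrow> real^2 \<Rightarrow> real" where
  "coordQ k x = orient k * (2 / (sqrt 3 * pi)) * (x $ 2 * cos (axis_angle k) - x $ 1 * sin (axis_angle k))"

text \<open>Adjacent wedges in the pairs \<open>(1,2)\<close>, \<open>(3,4)\<close>, \<open>(5,6)\<close> share their \<open>P\<close>-axis and have opposite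
  \<open>Q\<close>-axes. For \<open>k = 0\<close> any of these frames would do.\<close>

lemma coord_1: "x $ 1 = pi / 2 * coordP 1 x" "x $ 2 = sqrt 3 * pi / 2 * coordQ 1 x"
  by (simp_all add: coordP_def coordQ_def axis_angle_def orient_def)

lemma index_cases:
  assumes "k \<in> {1..6::nat}"
  obtains "k = 1" | "k = 2" | "k = 3" | "k = 4" | "k = 5" | "k = 6"
proof -
  have "k = 1 \<or> k = 2 \<or> k = 3 \<or> k = 4 \<or> k = 5 \<or> k = 6" using assms by auto
  then show ?thesis using that by blast
qed

text \<open>In these units a rotation by \<pi>/3 has a rational matrix, which reduces all frames to
  the first.\<close>

lemma coord_rotate:
  "k = 0 \<or> k = 1 \<or> k = 2 \<Longrightarrow> coordP k x = coordP 1 x \<and> coordQ k x = orient k * coordQ 1 x"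
  "k = 3 \<or> k = 4 \<Longrightarrow> coordP k x = (coordP 1 x - 3 * coordQ 1 x) / 2 \<and>
    coordQ k x = orient k * ((coordP 1 x + coordQ 1 x) / 2)"
  "k = 5 \<or> k = 6 \<Longrightarrow> coordP k x = (coordP 1 x + 3 * coordQ 1 x) / 2 \<and>
    coordQ k x = orient k * ((coordQ 1 x - coordP 1 x) / 2)"
  using real_sqrt_mult_self[of 3]
  by (auto simp: coordP_def coordQ_def axis_angle_def orient_def cos_60 sin_60 field_simps)

text \<open>The hexagonal lattice is invariant under rotation by \<pi>/3 in either sense. The two
  maps are mutually inverse, so preservation by each gives both equivalences.\<close>

lemma hex_lattice_rotate:
  "hex_lattice ((p + 3 * q) / 2) ((q - p) / 2) \<longleftrightarrow> hex_lattice p q"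
  "hex_lattice ((p - 3 * q) / 2) ((p + q) / 2) \<longleftrightarrow> hex_lattice p q"
proof -
  have 1: "hex_lattice ((p + 3 * q) / 2) ((q - p) / 2)" if pq: "hex_lattice p q" for p q
  proof -
    obtain a b :: int where ab: "even (a + b)" "p = 2 * of_int a" "q = 2 * of_int b"
      using pq unfolding hex_lattice_def by blast
    obtain n where "a + b = 2 * n" using ab(1) by (elim evenE)
    then have "a = 2 * n - b" by simp
    then show ?thesis using ab unfolding hex_lattice_def
      by (intro exI[of _ "n + b"] exI[of _ "b - n"]) auto
  qed
  have 2: "hex_lattice ((p - 3 * q) / 2) ((p + q) / 2)" if pq: "hex_lattice p q" for p q
  proof -
    obtain a b :: int where ab: "even (a + b)" "p = 2 * of_int a" "q = 2 * of_int b"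
      using pq unfolding hex_lattice_def by blast
    obtain n where "a + b = 2 * n" using ab(1) by (elim evenE)
    then have "a = 2 * n - b" by simp
    then show ?thesis using ab unfolding hex_lattice_def
      by (intro exI[of _ "n - 2 * b"] exI[of _ n]) auto
  qed
  have *: "(((p + 3 * q) / 2) - 3 * ((q - p) / 2)) / 2 = p" "((p + 3 * q) / 2 + (q - p) / 2) / 2 = q"
     "(((p - 3 * q) / 2) + 3 * ((p + q) / 2)) / 2 = p" "((p + q) / 2 - (p - 3 * q) / 2) / 2 = q"
    by (simp_all add: field_simps)
  show "hex_lattice ((p + 3 * q) / 2) ((q - p) / 2) \<longleftrightarrow> hex_lattice p q"
    using 1[of p q] 2[of "(p + 3 * q) / 2" "(q - p) / 2"] unfolding * by blast
  show "hex_lattice ((p - 3 * q) / 2) ((p + q) / 2) \<longleftrightarrow> hex_lattice p q"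
    using 2[of p q] 1[of "(p - 3 * q) / 2" "(p + q) / 2"] unfolding * by blast
qed

lemma orient_reflect: "hex_lattice p (orient k * q) \<longleftrightarrow> hex_lattice p q"
  by (simp add: orient_def hex_lattice_reflect)

lemma dual_Lam_coord_1: "x \<in> dual_lattice Lam \<longleftrightarrow> hex_lattice (coordP 1 x) (coordQ 1 x)"
proof -
  have "x \<in> dual_lattice Lam \<longleftrightarrow>
      (coordP 1 x + coordQ 1 x) / 4 \<in> \<int> \<and> coordQ 1 x / 2 \<in> \<int>"
  proof -
    have "(1 * x $ 1 + 1 / sqrt 3 * x $ 2) / (2 * pi) = (coordP 1 x + coordQ 1 x) / 4"
      "(0 * x $ 1 + 2 / sqrt 3 * x $ 2) / (2 * pi) = coordQ 1 x / 2"
      by (simp_all add: coord_1 add_divide_distrib)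
    then show ?thesis by (simp only: Lam_def dual_lattice_of)
  qed
  also have "\<dots> \<longleftrightarrow> hex_lattice (coordP 1 x) (coordQ 1 x)"
  proof
    assume "(coordP 1 x + coordQ 1 x) / 4 \<in> \<int> \<and> coordQ 1 x / 2 \<in> \<int>"
    then obtain m n where "(coordP 1 x + coordQ 1 x) / 4 = of_int m" "coordQ 1 x / 2 = of_int n"
      by (auto elim!: Ints_cases)
    then show "hex_lattice (coordP 1 x) (coordQ 1 x)"
      unfolding hex_lattice_def by (intro exI[of _ "2 * m - n"] exI[of _ n]) auto
  next
    assume "hex_lattice (coordP 1 x) (coordQ 1 x)"
    then obtain a b :: int where ab: "even (a + b)" "coordP 1 x = 2 * of_int a" "coordQ 1 x = 2 * of_int b"
      unfolding hex_lattice_def by blast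
    obtain n where "a + b = 2 * n" using ab(1) by (elim evenE)
    then have "a = 2 * n - b" by simp
    then show "(coordP 1 x + coordQ 1 x) / 4 \<in> \<int> \<and> coordQ 1 x / 2 \<in> \<int>" using ab by simp
  qed
  finally show ?thesis .
qed

lemma dual_Lam_coord:
  assumes "k \<in> {0..6}"
  shows "x \<in> dual_lattice Lam \<longleftrightarrow> hex_lattice (coordP k x) (coordQ k x)"
proof -
  consider "k = 0 \<or> k = 1 \<or> k = 2" | "k = 3 \<or> k = 4" | "k = 5 \<or> k = 6" using assms by fastforce
  then show ?thesis
    by cases (simp only: coord_rotate dual_Lam_coord_1 orient_reflect hex_lattice_rotate
        add.commute[of "coordQ 1 x" "coordP 1 x"])+
qed

lemma hexS_coord_1:
  "x \<in> hexS \<longleftrightarrow> hexagon (coordP 1 x / 2) (coordQ 1 x / 2)"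
proof -
  have *: "\<bar>u\<bar> \<le> r \<longleftrightarrow> \<bar>w\<bar> \<le> t" if "u = pi / 2 * w" "r = pi / 2 * t" for u w r t :: real
    unfolding that abs_mult by simp
  have "\<bar>x $ 1\<bar> \<le> pi \<longleftrightarrow> \<bar>coordP 1 x\<bar> \<le> 2"
    by (rule *) (simp_all add: coord_1)
  moreover have "\<bar>x $ 1 + sqrt 3 * x $ 2\<bar> \<le> 2 * pi \<longleftrightarrow> \<bar>coordP 1 x + 3 * coordQ 1 x\<bar> \<le> 4"
    by (rule *) (simp_all add: coord_1 algebra_simps)
  moreover have "\<bar>x $ 1 - sqrt 3 * x $ 2\<bar> \<le> 2 * pi \<longleftrightarrow> \<bar>coordP 1 x - 3 * coordQ 1 x\<bar> \<le> 4"
    by (rule *) (simp_all add: coord_1 algebra_simps)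
  ultimately show ?thesis unfolding hexS_def hexagon_def by auto
qed

lemma hexS_coord:
  assumes "k \<in> {0..6}"
  shows "x \<in> hexS \<longleftrightarrow> hexagon (coordP k x / 2) (coordQ k x / 2)"
proof -
  have "k \<in> {0,1,2} \<or> k \<in> {3,4} \<or> k \<in> {5,6}" using assms by auto
  then show ?thesis
    using coord_rotate[of k x] unfolding hexS_coord_1 hexagon_def orient_def by (auto; linarith)
qed

lemma hex_frame_coord:
  assumes "k \<in> {0..6}"
  shows "hex_frame (coordP k) (coordQ k) (pi\<^sup>2 / 4)"
proof (rule hex_frame.intro)
  show "linear (coordP k)" "linear (coordQ k)"
    by (rule linearI; simp add: coordP_def coordQ_def algebra_simps)+
  show "pi\<^sup>2 / 4 > 0" by simp
  show "x \<in> dual_lattice Lam \<longleftrightarrow> hex_lattice (coordP k x) (coordQ k x)" for x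
    using dual_Lam_coord[OF assms] .
  have o: "orient k * orient k = 1" by (simp add: orient_def)
  have s3: "sqrt 3 * sqrt 3 = 3" by simp
  have sc: "sin \<theta> * sin \<theta> = 1 - cos \<theta> * cos \<theta>" for \<theta> :: real
    using sin_cos_squared_add[of \<theta>] by (simp add: power2_eq_square algebra_simps)
  define C S where CS: "C = cos (axis_angle k)" "S = sin (axis_angle k)"
  have CS1: "S * S = 1 - C * C" unfolding CS by (rule sc)
  then have CS2: "C * C + S * S = 1" by simp
  show "x \<bullet> y = pi\<^sup>2 / 4 * (coordP k x * coordP k y + 3 * coordQ k x * coordQ k y)" for x y
  proof -
    have rescale: "pi\<^sup>2 / 4 * (2 / pi * u * (2 / pi * w)) = u * w"
      "pi\<^sup>2 / 4 * (3 * (o' * (2 / (sqrt 3 * pi)) * u) * (o' * (2 / (sqrt 3 * pi)) * w)) = o' * o' * (u * w)"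
      for u w o' :: real
      by (simp_all add: power2_eq_square field_simps)
    have "pi\<^sup>2 / 4 * (coordP k x * coordP k y) = (x $ 1 * C + x $ 2 * S) * (y $ 1 * C + y $ 2 * S)"
      unfolding coordP_def CS by (rule rescale)
    moreover have "pi\<^sup>2 / 4 * (3 * coordQ k x * coordQ k y) =
        orient k * orient k * ((x $ 2 * C - x $ 1 * S) * (y $ 2 * C - y $ 1 * S))"
      unfolding coordQ_def CS by (rule rescale)
    moreover have "(x $ 1 * C + x $ 2 * S) * (y $ 1 * C + y $ 2 * S) +
        (x $ 2 * C - x $ 1 * S) * (y $ 2 * C - y $ 1 * S) = (x $ 1 * y $ 1 + x $ 2 * y $ 2) * (C * C + S * S)"
      by (simp add: algebra_simps)
    ultimately show ?thesis
      by (simp only: distrib_left[of "pi\<^sup>2 / 4"] o CS2 mult_1 mult_1_right inner_vec_def sum_2 inner_real_def)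
  qed
  show "\<exists>x. coordP k x = a \<and> coordQ k x = b" for a b
  proof -
    \<comment> \<open>The witness undoes the scaling of the coordinates and then the
      rotation.\<close>
    let ?u = "pi / 2 * a" and ?w = "orient k * (sqrt 3 * pi / 2) * b"
    let ?x = "vector [?u * C - ?w * S, ?u * S + ?w * C] :: real^2"
    have "coordP k ?x = 2 / pi * (?u * (C * C + S * S))"
      by (simp add: coordP_def algebra_simps flip: CS)
    moreover have "coordQ k ?x = orient k * (2 / (sqrt 3 * pi)) * (?w * (C * C + S * S))"
      by (simp add: coordQ_def algebra_simps flip: CS)
    ultimately show ?thesis by (intro exI[of _ ?x]) (simp add: CS1 o)
  qed
qed

section \<open>The dual lattices of the \<open>Gam k\<close> in coordinates\<close>

lemma dual_Gam_0: "\<gamma> \<in> dual_lattice (Gam 0) \<longleftrightarrow> hex_lattice (2 * coordP 0 \<gamma>) (2 * coordQ 0 \<gamma>)"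
proof -
  interpret hex_frame "coordP 0" "coordQ 0" "pi\<^sup>2 / 4" by (rule hex_frame_coord) simp
  have "\<gamma> \<in> dual_lattice (Gam 0) \<longleftrightarrow> 2 *\<^sub>R \<gamma> \<in> dual_lattice Lam"
    unfolding dual_lattice_def Gam_def by simp
  then show ?thesis by (simp add: dual_Lam)
qed

text \<open>For each pair of wedges the two generator conditions differ from integrality of
  \<open>P\<close> and \<open>Q\<close> by a unimodular change of variables.\<close>

lemma dual_Gam:
  assumes "k \<in> {1..6}"
  shows "\<gamma> \<in> dual_lattice (Gam k) \<longleftrightarrow> coordP k \<gamma> \<in> \<int> \<and> coordQ k \<gamma> \<in> \<int>"
proof -
  have sqrt3: "sqrt 3 * (sqrt 3 * u) = 3 * u" for u by (simp flip: mult.assoc)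
  have sgn: "orient k * u \<in> \<int> \<longleftrightarrow> u \<in> \<int>" for u by (simp add: orient_def)
  let ?p = "coordP 1 \<gamma>" and ?q = "coordQ 1 \<gamma>"
  consider "k = 1 \<or> k = 2" | "k = 3 \<or> k = 4" | "k = 5 \<or> k = 6" using assms by fastforce
  then show ?thesis
  proof cases
    case 1
    have "(4 * \<gamma> $ 1 + (- 4 / sqrt 3) * \<gamma> $ 2) / (2 * pi) = ?p - ?q"
      "(4 * \<gamma> $ 1 + 0 * \<gamma> $ 2) / (2 * pi) = ?p"
      by (simp_all add: coord_1 diff_divide_distrib)
    moreover have "Gam k = lattice_of (vector [vector [4, 4], vector [- 4 / sqrt 3, 0]])"
      using 1 by (auto simp: Gam_def)
    ultimately have "\<gamma> \<in> dual_lattice (Gam k) \<longleftrightarrow> ?p - ?q \<in> \<int> \<and> ?p \<in> \<int>"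
      by (simp only: dual_lattice_of)
    also have "\<dots> \<longleftrightarrow> ?p \<in> \<int> \<and> ?q \<in> \<int>"
      using Ints_diff[of ?p "?p - ?q"] by auto
    finally show ?thesis using coord_rotate(1)[OF disjI2[OF 1]] by (simp only: sgn)
  next
    case 2
    let ?p' = "(?p - 3 * ?q) / 2" and ?q' = "(?p + ?q) / 2"
    have "(0 * \<gamma> $ 1 + (8 / sqrt 3) * \<gamma> $ 2) / (2 * pi) = ?q' - ?p'"
      "((- 2) * \<gamma> $ 1 + (2 * sqrt 3) * \<gamma> $ 2) / (2 * pi) = - ?p'"
      by (simp_all add: coord_1 diff_divide_distrib add_divide_distrib sqrt3)
    moreover have "Gam k = lattice_of (vector [vector [0, - 2], vector [8 / sqrt 3, 2 * sqrt 3]])"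
      using 2 by (auto simp: Gam_def)
    ultimately have "\<gamma> \<in> dual_lattice (Gam k) \<longleftrightarrow> ?q' - ?p' \<in> \<int> \<and> - ?p' \<in> \<int>"
      by (simp only: dual_lattice_of)
    also have "\<dots> \<longleftrightarrow> ?p' \<in> \<int> \<and> ?q' \<in> \<int>"
      using Ints_add[of "?q' - ?p'" ?p'] Ints_minus[of ?p'] Ints_minus[of "- ?p'"] Ints_diff[of ?q' ?p'] by auto
    finally show ?thesis using 2 by (simp only: coord_rotate sgn)
  next
    case 3
    let ?p' = "(?p + 3 * ?q) / 2" and ?q' = "(?q - ?p) / 2"
    have "(4 * \<gamma> $ 1 + (4 / sqrt 3) * \<gamma> $ 2) / (2 * pi) = ?p' - ?q'"
      "(2 * \<gamma> $ 1 + (2 * sqrt 3) * \<gamma> $ 2) / (2 * pi) = ?p'"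
      by (simp_all add: coord_1 diff_divide_distrib add_divide_distrib sqrt3)
    moreover have "Gam k = lattice_of (vector [vector [4, 2], vector [4 / sqrt 3, 2 * sqrt 3]])"
      using 3 by (auto simp: Gam_def)
    ultimately have "\<gamma> \<in> dual_lattice (Gam k) \<longleftrightarrow> ?p' - ?q' \<in> \<int> \<and> ?p' \<in> \<int>"
      by (simp only: dual_lattice_of)
    also have "\<dots> \<longleftrightarrow> ?p' \<in> \<int> \<and> ?q' \<in> \<int>"
      using Ints_diff[of ?p' "?p' - ?q'"] by auto
    finally show ?thesis using 3 by (simp only: coord_rotate sgn)
  qed
qed

section \<open>The pieces of the partition in coordinates\<close>

lemma A0_coord:
  assumes "k \<in> {0..6}"
  shows "x \<in> A0 \<longleftrightarrow> hexagon (coordP k x) (coordQ k x)"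
proof -
  interpret hex_frame "coordP k" "coordQ k" "pi\<^sup>2 / 4" by (rule hex_frame_coord[OF assms])
  have "x \<in> A0 \<longleftrightarrow> 2 *\<^sub>R x \<in> hexS"
    unfolding A0_def by (auto intro: image_eqI[where x = "2 *\<^sub>R x"])
  then show ?thesis by (simp add: hexS_coord[OF assms])
qed

lemma Theta_eq:
  assumes "k \<in> {1..6}"
  shows "Theta k = (\<lambda>\<phi>. axis_angle k + orient k * \<phi>) ` {0..pi / 6}"
proof -
  have im: "(\<lambda>\<phi>. a + \<phi>) ` {0..pi/6} = {a..a + pi/6}" "(\<lambda>\<phi>. a - \<phi>) ` {0..pi/6} = {a - pi/6..a}" for a :: real
    by (auto intro: image_eqI[where x = "_ - a"] image_eqI[where x = "a - _"])
  show ?thesis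
    using assms by (cases rule: index_cases) (simp_all add: Theta_def axis_angle_def orient_def im)
qed

text \<open>With \<phi> measured from the axis towards the wedge, \<open>P\<close> and
  \<open>Q\<close> are proportional to cos \<phi> and sin \<phi> / sqrt 3. Since tan(\<pi>/6) = 1 /
  sqrt 3, the far side of the wedge becomes \<open>3 * Q = P\<close>.\<close>

lemma has_polar_angle_in_Theta:
  assumes k: "k \<in> {1..6}"
  shows "has_polar_angle_in x (Theta k) \<longleftrightarrow> 0 < coordP k x \<and> 0 \<le> coordQ k x \<and> 3 * coordQ k x \<le> coordP k x"
proof -
  interpret hex_frame "coordP k" "coordQ k" "pi\<^sup>2 / 4" using k by (intro hex_frame_coord) auto
  define pol where "pol r \<phi> = (vector [r * cos (axis_angle k + orient k * \<phi>),
    r * sin (axis_angle k + orient k * \<phi>)] :: real^2)" for r \<phi>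
  have P: "coordP k (pol r \<phi>) = 2 / pi * (r * cos \<phi>)" for r \<phi>
  proof -
    have "coordP k (pol r \<phi>) = 2 / pi * (r * cos (axis_angle k + orient k * \<phi> - axis_angle k))"
      unfolding coordP_def pol_def cos_diff by (simp add: algebra_simps)
    then show ?thesis by (simp add: orient_def)
  qed
  have Q: "coordQ k (pol r \<phi>) = 2 / (sqrt 3 * pi) * (r * sin \<phi>)" for r \<phi>
  proof -
    have "coordQ k (pol r \<phi>) = orient k * (2 / (sqrt 3 * pi)) * (r * sin (axis_angle k + orient k * \<phi> - axis_angle k))"
      unfolding coordQ_def pol_def sin_diff by (simp add: algebra_simps)
    then show ?thesis by (simp add: orient_def)
  qed
  have iff: "has_polar_angle_in x (Theta k) \<longleftrightarrow> (\<exists>r>0. \<exists>\<phi>\<in>{0..pi/6}. x = pol r \<phi>)"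
    unfolding has_polar_angle_in_def Theta_eq[OF k] pol_def by auto
  show ?thesis
  proof
    assume "has_polar_angle_in x (Theta k)"
    then obtain r \<phi> where r: "r > 0" and \<phi>: "0 \<le> \<phi>" "\<phi> \<le> pi / 6" and x: "x = pol r \<phi>"
      unfolding iff by auto
    have c: "cos \<phi> \<ge> sqrt 3 / 2" using cos_monotone_0_pi_le[of \<phi> "pi/6"] \<phi> by (simp add: cos_30)
    have s: "sin \<phi> \<le> 1 / 2" using sin_monotone_2pi_le[of \<phi> "pi/6"] \<phi> by (simp add: sin_30)
    have s0: "sin \<phi> \<ge> 0" using \<phi> by (intro sin_ge_zero) auto
    have "3 * sin \<phi> \<le> sqrt 3 * cos \<phi>"
    proof -
      have "sqrt 3 * (sqrt 3 / 2) \<le> sqrt 3 * cos \<phi>" using c by (intro mult_left_mono) auto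
      then show ?thesis using s by simp
    qed
    then have "r * (3 * sin \<phi>) \<le> r * (sqrt 3 * cos \<phi>)" using r by (intro mult_left_mono) auto
    moreover have "cos \<phi> > 0" using c less_le_trans[of 0 "sqrt 3 / 2"] by simp
    ultimately show "0 < coordP k x \<and> 0 \<le> coordQ k x \<and> 3 * coordQ k x \<le> coordP k x"
      using r s0 by (simp add: x P Q field_simps)
  next
    assume pq: "0 < coordP k x \<and> 0 \<le> coordQ k x \<and> 3 * coordQ k x \<le> coordP k x"
    \<comment> \<open>\<open>t\<close> is the slope seen from the axis, hence the tangent of the
      angle to be recovered.\<close>
    define t where "t = sqrt 3 * coordQ k x / coordP k x"
    define \<phi> where "\<phi> = arctan t"
    define r where "r = pi / 2 * coordP k x / cos \<phi>"
    have t: "0 \<le> t" "t \<le> 1 / sqrt 3"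
      using pq by (auto simp: t_def field_simps)
    have "arctan (1 / sqrt 3) = pi / 6"
      by (rule arctan_unique) (auto simp: tan_30)
    then have \<phi>: "0 \<le> \<phi>" "\<phi> \<le> pi / 6" using t arctan_monotone'[of t "1 / sqrt 3"] by (auto simp: \<phi>_def)
    have c: "cos \<phi> > 0" unfolding \<phi>_def by (rule cos_gt_zero_pi[OF arctan_lbound arctan_ubound])
    have "sin \<phi> = t * cos \<phi>"
      using tan_arctan[of t] c unfolding tan_def \<phi>_def by (simp add: field_simps)
    then have "x = pol r \<phi>" using c pq
      by (intro coord_eqI) (simp_all add: P Q r_def t_def)
    moreover have "r > 0" using c pq by (simp add: r_def)
    ultimately show "has_polar_angle_in x (Theta k)" unfolding iff using \<phi> by (intro exI[of _ r] conjI bexI[of _ \<phi>]) auto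
  qed
qed

lemma hexagon_minus: "hexagon (- p) (- q) \<longleftrightarrow> hexagon p q"
  unfolding hexagon_def by linarith

text \<open>Inside the wedge \<open>p + 3 * q \<le> 2 * p\<close>, so the slanted sides of the
  hexagons impose nothing beyond the bounds on \<open>p\<close>.\<close>

lemma wedge_minus_hexagon:
  "hexagon (p / 2) (q / 2) \<and> \<not> hexagon p q \<and> 0 < p \<and> 0 \<le> q \<and> 3 * q \<le> p \<longleftrightarrow> trap p q \<and> 1 < p"
  unfolding hexagon_def trap_def by linarith

lemma partA_coord:
  assumes k: "k \<in> {1..6}"
  shows "x \<in> partA k \<longleftrightarrow>
    (\<exists>s\<in>{1,-1}. trap (s * coordP k x) (s * coordQ k x) \<and> 1 < s * coordP k x)"
proof -
  have k': "k \<in> {0..6}" "k \<noteq> 0" using k by auto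
  interpret hex_frame "coordP k" "coordQ k" "pi\<^sup>2 / 4" by (rule hex_frame_coord[OF k'(1)])
  have neg: "coordP k (- x) = - coordP k x" "coordQ k (- x) = - coordQ k x"
    using linear_neg[OF lin(1)] linear_neg[OF lin(2)] by auto
  have "x \<in> partA k \<longleftrightarrow> (hexagon (coordP k x / 2) (coordQ k x / 2) \<and> \<not> hexagon (coordP k x) (coordQ k x)) \<and>
    (\<exists>s\<in>{1,-1}. 0 < s * coordP k x \<and> 0 \<le> s * coordQ k x \<and> 3 * (s * coordQ k x) \<le> s * coordP k x)"
    using k'(2) by (simp add: partA_def hexS_coord[OF k'(1)] A0_coord[OF k'(1)] has_polar_angle_in_Theta[OF k] neg)
  also have "\<dots> \<longleftrightarrow> (\<exists>s\<in>{1,-1}. trap (s * coordP k x) (s * coordQ k x) \<and> 1 < s * coordP k x)"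
    using wedge_minus_hexagon[of "coordP k x" "coordQ k x"] wedge_minus_hexagon[of "- coordP k x" "- coordQ k x"]
    by (auto simp: hexagon_minus)
  finally show ?thesis .
qed

lemma trap_frame_coord:
  assumes k: "k \<in> {1..6}"
  shows "trap_frame (coordP k) (coordQ k) (pi\<^sup>2 / 4) (calA k) (dual_lattice (Gam k))"
proof -
  have k': "k \<in> {0..6}" using k by auto
  interpret hex_frame "coordP k" "coordQ k" "pi\<^sup>2 / 4" by (rule hex_frame_coord[OF k'])
  let ?R = "\<lambda>p q. \<exists>s\<in>{1,-1}. trap (s * p) (s * q) \<and> 1 < s * p"
  have "calA k = {x. ?R (coordP k x) (coordQ k x)} + dual_lattice Lam"
  proof -
    have "partA k = {x. ?R (coordP k x) (coordQ k x)}" using partA_coord[OF k] by blast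
    then show ?thesis unfolding calA_def by simp
  qed
  then show ?thesis
    using dual_Gam[OF k] mem_periodic[of _ ?R] by unfold_locales (simp_all only:)
qed

lemma hexagon_frame_coord:
  "hexagon_frame (coordP 0) (coordQ 0) (pi\<^sup>2 / 4) (calA 0) (dual_lattice (Gam 0))"
proof -
  interpret hex_frame "coordP 0" "coordQ 0" "pi\<^sup>2 / 4" by (rule hex_frame_coord) simp
  have "calA 0 = {x. hexagon (coordP 0 x) (coordQ 0 x)} + dual_lattice Lam"
  proof -
    have "A0 = {x. hexagon (coordP 0 x) (coordQ 0 x)}" using A0_coord[of 0] by auto
    then show ?thesis unfolding calA_def partA_def by simp
  qed
  then show ?thesis
    using dual_Gam_0 mem_periodic[of _ hexagon] by unfold_locales (simp_all only: hexagons_def)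
qed

section \<open>Both tilings combined, and the theorem\<close>

lemma shift_in_frontier:
  assumes k: "k \<in> {0..6}" and \<gamma>: "\<gamma> \<in> dual_lattice (Gam k) - dual_lattice Lam"
    and x: "x \<in> closure (calA k)" "x + \<gamma> \<in> closure (calA k)"
  shows "x \<in> frontier (calA k)"
proof (cases "k = 0")
  case True
  interpret hexagon_frame "coordP 0" "coordQ 0" "pi\<^sup>2 / 4" "calA 0" "dual_lattice (Gam 0)"
    by (rule hexagon_frame_coord)
  show ?thesis using in_frontier_A \<gamma> x unfolding True closure_A by blast
next
  case False
  interpret trap_frame "coordP k" "coordQ k" "pi\<^sup>2 / 4" "calA k" "dual_lattice (Gam k)"
    using k False by (intro trap_frame_coord) auto
  show ?thesis using in_frontier_A \<gamma> x unfolding closure_A by blast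
qed

text \<open>For \<open>k \<ge> 1\<close> the partner of \<open>k\<close> in the pairs (1,2), (3,4),
  (5,6) has the same lattice and the reflected frame. It therefore belongs to
  \<open>Idx \<gamma>\<close>, and \<open>other\<close> applied to it gives the mirror condition of
  \<open>local_cover\<close>.\<close>

lemma normal_extension_covered:
  assumes k: "k \<in> {0..6}" and \<gamma>: "\<gamma> \<in> dual_lattice (Gam k) - dual_lattice Lam"
    and x: "x \<in> closure (calA k)" "x + \<gamma> \<in> closure (calA k)"
    and other: "\<And>k'. k' \<in> Idx \<gamma> - {k} \<Longrightarrow> \<not> (x \<in> closure (calA k') \<and> x + \<gamma> \<in> closure (calA k'))"
  obtains \<delta> where "\<delta> > 0" "\<And>y. norm (y - x) < \<delta> \<Longrightarrow> y \<noteq> x \<Longrightarrow>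
    normal_at (frontier (calA k)) x (y - x) \<Longrightarrow> y \<in> closure (calA k) \<or> y + \<gamma> \<in> closure (calA k)"
proof (cases "k = 0")
  case True
  interpret hexagon_frame "coordP 0" "coordQ 0" "pi\<^sup>2 / 4" "calA 0" "dual_lattice (Gam 0)"
    by (rule hexagon_frame_coord)
  show ?thesis using local_cover \<gamma> x that unfolding True by (metis DiffE)
next
  case False
  then have k1: "k \<in> {1..6}" using k by auto
  interpret trap_frame "coordP k" "coordQ k" "pi\<^sup>2 / 4" "calA k" "dual_lattice (Gam k)"
    by (rule trap_frame_coord[OF k1])
  define k' where "k' = (if odd k then k + 1 else k - 1)"
  have k'1: "k' \<in> {1..6}" and Gam': "Gam k' = Gam k" and ne: "k' \<noteq> k"
    and coord': "coordP k' y = coordP k y" "coordQ k' y = - coordQ k y" for y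
    using k1 by (cases rule: index_cases;
      simp add: k'_def Gam_def coordP_def coordQ_def axis_angle_def orient_def)+
  interpret mirror: trap_frame "coordP k'" "coordQ k'" "pi\<^sup>2 / 4" "calA k'" "dual_lattice (Gam k')"
    by (rule trap_frame_coord[OF k'1])
  have "k' \<in> Idx \<gamma> - {k}" using k'1 Gam' ne \<gamma> unfolding Idx_def by auto
  from other[OF this] have "\<not> (traps (coordP k x) (- coordQ k x) \<and> traps (coordP k (x + \<gamma>)) (- coordQ k (x + \<gamma>)))"
    unfolding mirror.closure_A mem_Collect_eq coord' .
  from local_cover[OF _ _ x this] show ?thesis using \<gamma> that by blast
qed

lemma Ceps_0: "x \<in> Ceps 0 k \<gamma> \<longleftrightarrow> x \<in> closure (calA k) \<and> x + \<gamma> \<in> closure (calA k)"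
proof -
  have "closure (calA k) + cball 0 0 = closure (calA k)" by (auto simp: set_plus_def)
  then show ?thesis unfolding Ceps_def by (auto intro: image_eqI[where x = "x + \<gamma>"])
qed

lemma Ceps_mono: "0 \<le> \<epsilon> \<Longrightarrow> Ceps 0 k \<gamma> \<subseteq> Ceps \<epsilon> k \<gamma>"
proof -
  assume "0 \<le> \<epsilon>"
  then have "closure (calA k) + cball 0 0 \<subseteq> closure (calA k) + cball 0 \<epsilon>"
    by (intro set_plus_mono2) auto
  then show ?thesis unfolding Ceps_def by blast
qed

theorem proposition4:
  fixes \<epsilon> :: real and k :: nat and \<gamma> :: "real^2" and m :: "nat \<Rightarrow> real^2 \<Rightarrow> complex"
  assumes "0 < \<epsilon>" and "\<epsilon> < sqrt 3 * pi / 12"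
    and "k \<in> {0..6}"
    and "\<gamma> \<in> dual_lattice (Gam k) - dual_lattice Lam"
    and "\<And>k'. k' \<in> {0..6} \<Longrightarrow> L2_torus (m k')"
    and "\<And>k'. k' \<in> {0..6} \<Longrightarrow> closure (calA k') \<subseteq> ess_supp (m k')"
    and "\<And>k'. k' \<in> {0..6} \<Longrightarrow> ess_supp (m k') \<subseteq> closure (calA k') + cball 0 \<epsilon>"
  shows "Ceps 0 k \<gamma> - (\<Union>k' \<in> Idx \<gamma> - {k}. Ceps \<epsilon> k' \<gamma>) \<subseteq> frontier (calA k) \<and>
    (perfect_shift_cancellation m \<longrightarrow>
      \<not> nonzero_normal_extension (m k) (calA k)
          (Ceps 0 k \<gamma> - (\<Union>k' \<in> Idx \<gamma> - {k}. Ceps \<epsilon> k' \<gamma>)))"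
proof (intro conjI impI notI)
  let ?P = "Ceps 0 k \<gamma> - (\<Union>k' \<in> Idx \<gamma> - {k}. Ceps \<epsilon> k' \<gamma>)"
  show "?P \<subseteq> frontier (calA k)"
    using shift_in_frontier[OF assms(3,4)] by (auto simp: Ceps_0)
  assume psc: "perfect_shift_cancellation m" and ext: "nonzero_normal_extension (m k) (calA k) ?P"
  from ext obtain x where x: "x \<in> ?P" and y: "\<And>\<delta>. \<delta> > 0 \<Longrightarrow> \<exists>y.
       y \<notin> closure (calA k) \<and> normal_at (frontier (calA k)) x (y - x) \<and>
       0 < norm (y - x) \<and> norm (y - x) < \<delta> \<and> m k y \<noteq> 0 \<and>
       (\<forall>z \<in> closed_segment x y. isCont (m k) z)"
    unfolding nonzero_normal_extension_def by blast
  \<comment> \<open>Removing the larger sets \<open>Ceps \<epsilon> k' \<gamma>\<close> also removes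
    every \<open>Ceps 0 k' \<gamma>\<close>, hence the T-junctions.\<close>
  have "\<not> (x \<in> closure (calA k') \<and> x + \<gamma> \<in> closure (calA k'))" if "k' \<in> Idx \<gamma> - {k}" for k'
    using x that Ceps_mono[of \<epsilon> k' \<gamma>] assms(1) Ceps_0[of x k' \<gamma>] by auto
  then obtain \<delta>1 where \<delta>1: "\<delta>1 > 0" "\<And>y. norm (y - x) < \<delta>1 \<Longrightarrow> y \<noteq> x \<Longrightarrow>
    normal_at (frontier (calA k)) x (y - x) \<Longrightarrow> y \<in> closure (calA k) \<or> y + \<gamma> \<in> closure (calA k)"
    using normal_extension_covered[OF assms(3,4)] x unfolding Diff_iff Ceps_0 by metis
  let ?O = "- (\<Union>k'\<in>Idx \<gamma> - {k}. Ceps \<epsilon> k' \<gamma>)"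
  have "open ?O" using closed_Ceps by (intro open_Compl closed_UN) (auto simp: Idx_def)
  moreover have "x \<in> ?O" using x by blast
  ultimately obtain \<delta>2 where \<delta>2: "\<delta>2 > 0" "ball x \<delta>2 \<subseteq> ?O" by (rule openE)
  obtain y where y: "y \<notin> closure (calA k)" "normal_at (frontier (calA k)) x (y - x)"
       "0 < norm (y - x)" "norm (y - x) < min \<delta>1 \<delta>2" "m k y \<noteq> 0"
       "\<forall>z \<in> closed_segment x y. isCont (m k) z"
    using y[of "min \<delta>1 \<delta>2"] \<delta>1(1) \<delta>2(1) by auto
  have k: "k \<in> Idx \<gamma>" using assms(3,4) by (simp add: Idx_def)
  \<comment> \<open>Intersecting the lattices enlarges the dual.\<close>
  have "dual_lattice (Gam k) \<subseteq> dual_lattice GamAll"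
    using assms(3) unfolding dual_lattice_def GamAll_def by blast
  then have \<gamma>: "\<gamma> \<in> dual_lattice GamAll - dual_lattice Lam" using assms(4) by blast
  have "y \<in> ball x \<delta>2" using y(4) by (simp add: dist_norm norm_minus_commute)
  then have off: "y \<notin> Ceps \<epsilon> k' \<gamma>" if "k' \<in> Idx \<gamma> - {k}" for k' using \<delta>2(2) that by blast
  have sup: "ess_supp (m k') \<subseteq> closure (calA k') + cball 0 \<epsilon>" if "k' \<in> Idx \<gamma>" for k'
    using assms(7)[of k'] that by (simp add: Idx_def)
  have "isCont (m k) y" using y(6) by simp
  then have "y + \<gamma> \<notin> ess_supp (m k)"
    using shift_cancellation_no_extension[OF k \<gamma> psc sup off] y(5) by blast
  \<comment> \<open>Since \<open>y\<close> lies outside the closure, the covering must come from the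
    translate. The lower support bound then contradicts the vanishing of \<open>m k\<close> near
    \<open>y + \<gamma>\<close>.\<close>
  moreover have "y + \<gamma> \<in> closure (calA k)" using \<delta>1(2)[of y] y(1-4) by auto
  ultimately show False using assms(6)[OF assms(3)] by blast
qed

end
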